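(* Let $0<c<1$, let $|\mathcal C_1|$ be the length of the cycle that contains $1$, and for each $n$ let $\nu_0$ be the law on $\mathcal S_n$ of the product of $t=\lfloor cn/2\rfloor$ random transpositions conditioned on no fragmentation. Then under $\nu_0$, as $n\to\infty$, $$P(|\mathcal C_1|=k)\to\frac1c\,\frac{k^{k-1}}{k!}\,(ce^{-c})^k\qquad\text{for all }k\ge1 .$$
   Context: $\mathcal S_n$ is the set of permutations of $\{1,\dots,n\}$ and $d(\sigma)$ is the minimal number of transpositions whose product is $\sigma$. Let $\tau_1,\tau_2,\dots$ be i.i.d. uniform transpositions in $\mathcal S_n$ and consider the random walk with successive positions $I,\tau_1,\tau_1\tau_2,\dots$. A step is a fragmentation if the transposition involves two indices in the same cycle (so that this cycle is split and the distance $d$ to the identity decreases by one); otherwise two cycles merge and $d$ increases by one. With $t=\lfloor cn/2\rfloor$, $\nu_0$ is the law of $\tau_1\cdots\tau_t$ conditional on none of the first $t$ steps being a fragmentation; equivalently, it is the hitting distribution of the sphere $\{\sigma:d(\sigma)=\lfloor cn/2\rfloor\}$ by the random walk, conditioned on no fragmentation before the hitting time. *)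

theory Defs
  imports "HOL-Probability.Probability" "HOL-Combinatorics.Combinatorics"
begin

definition transpositions :: "nat \<Rightarrow> (nat \<Rightarrow> nat) set" where
  "transpositions n =
     {Transposition.transpose a b | a b. a \<in> {1..n} \<and> b \<in> {1..n} \<and> a \<noteq> b}"

text \<open>
  For a permutation \<open>\<sigma>\<close> of a finite set, \<^term>\<open>orbit \<sigma> a\<close> is the cycle of
  \<open>\<sigma>\<close> containing \<open>a\<close>; it contains \<open>a\<close> itself, also when \<open>a\<close> is a fixed point.
\<close>

definition fragmentation :: "(nat \<Rightarrow> nat) \<Rightarrow> (nat \<Rightarrow> nat) \<Rightarrow> bool" where
  "fragmentation \<sigma> \<tau> \<longleftrightarrow>
     (\<exists>a b. a \<noteq> b \<and> \<tau> = Transposition.transpose a b \<and> b \<in> orbit \<sigma> a)"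

text \<open>
  A list \<open>[\<tau>\<^sub>1, \<dots>, \<tau>\<^sub>t]\<close> is the sequence of steps of the walk; its position after
  \<open>i\<close> steps is \<open>\<tau>\<^sub>1 \<circ> \<dots> \<circ> \<tau>\<^sub>i\<close>, so steps act by right multiplication.
\<close>

definition walk :: "(nat \<Rightarrow> nat) list \<Rightarrow> nat \<Rightarrow> nat \<Rightarrow> nat" where
  "walk \<tau>s i = foldl (\<circ>) id (take i \<tau>s)"

definition no_fragmentation :: "(nat \<Rightarrow> nat) list \<Rightarrow> bool" where
  "no_fragmentation \<tau>s \<longleftrightarrow> (\<forall>i<length \<tau>s. \<not> fragmentation (walk \<tau>s i) (\<tau>s ! i))"

text \<open>
  The conditioning event has positive probability whenever \<open>t < n\<close> (the transpositions
  may be taken along the edges of a forest), which is the only case of interest;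
  \<^const>\<open>cond_pmf\<close> is unspecified otherwise.
\<close>

definition nu0 :: "nat \<Rightarrow> nat \<Rightarrow> (nat \<Rightarrow> nat) pmf" where
  "nu0 n t =
     map_pmf (\<lambda>\<tau>s. walk \<tau>s t)
       (cond_pmf (replicate_pmf t (pmf_of_set (transpositions n))) {\<tau>s. no_fragmentation \<tau>s})"

end

theory Submission
  imports Defs
begin

text \<open>
  A step of the walk joins two indices lying in different cycles exactly when it is not a
  fragmentation, and then it merges these cycles. Hence the first \<open>t\<close> steps contain no
  fragmentation exactly when their supports, read as edges on \<open>{1..n}\<close>, are distinct and form a
  forest, and then the cycles of the endpoint are the components of that forest
  (\<open>no_fragmentation_iff_forest\<close>). Each forest with \<open>t\<close> edges arises from \<open>t!\<close> step lists, so under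
  \<open>\<nu>\<^sub>0\<close> the cycle of \<open>1\<close> has the law of the component of \<open>1\<close> in a uniform forest with \<open>t\<close> edges
  (\<open>nu0_cycle_length\<close>).

  Let \<open>U = \<Sum> k\<^bsup>k-2\<^esup> / k! x\<^bsup>k\<^esup>\<close> be the exponential generating function of trees; its coefficients are
  given by Cayley's formula (\<open>card_spanning_trees\<close>). Splitting off the component of a vertex shows
  that the number of forests on \<open>n\<close> vertices with \<open>m = n - t\<close> components is \<open>n! / m!\<close> times the
  coefficient \<open>[x\<^bsup>n\<^esup>] U\<^bsup>m\<^esup>\<close> (\<open>card_forests\<close>). The probability in question thereby becomes
  \<open>k (m / n) u\<^sub>k [x\<^bsup>n-k\<^esup>] U\<^bsup>m-1\<^esup> / [x\<^bsup>n\<^esup>] U\<^bsup>m\<^esup>\<close>, where \<open>u\<^sub>k\<close> is the \<open>k\<close>-th coefficient of \<open>U\<close>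
  (\<open>card_forests_part_size_ratio\<close>).

  For \<open>x > 0\<close> inside the disc of convergence, the numbers \<open>u\<^sub>j x\<^bsup>j\<^esup> / U(x)\<close> form a probability distribution on the
  component sizes, \<open>[x\<^bsup>n\<^esup>] U\<^bsup>m\<^esup>\<close> is up to a factor the probability that \<open>m\<close> independent sizes add up to
  \<open>n\<close>, and the quotient above is the expected proportion of sizes equal to \<open>k\<close> given that sum. If the
  mean size is \<open>\<mu> = lim n / m\<close>, the conditioning event is not exponentially unlikely
  (\<open>fps_power_coeff_subexponential\<close>), whereas the proportion of sizes \<open>k\<close> deviates from its mean
  only with exponentially small probability; so the conditional expectation tends to
  \<open>u\<^sub>k x\<^bsup>k\<^esup> / U(x)\<close> (\<open>fps_power_part_frequency\<close>).

  It remains to find \<open>x\<close>. The rooted tree series \<open>T = x U'\<close> satisfies \<open>T = x exp T\<close> and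
  \<open>U = T - T\<^sup>2 / 2\<close>, so that \<open>x = c exp (- c)\<close> with \<open>c < 1\<close> gives \<open>T(x) = c\<close>, \<open>U(x) = c (1 - c / 2)\<close>
  and mean \<open>T(x) / U(x) = 1 / (1 - c / 2)\<close>, which is the limit of \<open>n / m\<close> for \<open>t = \<lfloor>cn/2\<rfloor>\<close>
  (\<open>tree_fps_at_saddle\<close>).
\<close>

section \<open>Forests and their components\<close>

text \<open>
  Graphs are given by their sets of edges, an edge being a two-element set of vertices, so that the
  relation below is symmetric by construction. Isolated vertices are present implicitly.
\<close>

definition conn :: "'a set set \<Rightarrow> ('a \<times> 'a) set" where
  "conn E = {(a, b). {a, b} \<in> E}\<^sup>*"

lemma conn_refl [simp]: "(x, x) \<in> conn E"
  by (simp add: conn_def)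

lemma conn_sym: "(x, y) \<in> conn E \<Longrightarrow> (y, x) \<in> conn E"
proof -
  have "sym {(a, b). {a, b} \<in> E}" by (auto simp: sym_def insert_commute)
  thus "(x, y) \<in> conn E \<Longrightarrow> (y, x) \<in> conn E"
    unfolding conn_def by (rule symD[OF sym_rtrancl])
qed

lemma conn_commute: "(x, y) \<in> conn E \<longleftrightarrow> (y, x) \<in> conn E"
  by (blast intro: conn_sym)

lemma conn_trans: "(x, y) \<in> conn E \<Longrightarrow> (y, z) \<in> conn E \<Longrightarrow> (x, z) \<in> conn E"
  by (auto simp: conn_def)

lemma conn_mono: "E \<subseteq> E' \<Longrightarrow> conn E \<subseteq> conn E'"
  unfolding conn_def by (intro rtrancl_mono) auto

lemma conn_insert_iff:
  "(x, y) \<in> conn (insert {a, b} E) \<longleftrightarrow>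
     (x, y) \<in> conn E \<or> (x, a) \<in> conn E \<and> (b, y) \<in> conn E \<or> (x, b) \<in> conn E \<and> (a, y) \<in> conn E"
proof -
  have "{(x, y). {x, y} \<in> insert {a, b} E} = insert (a, b) (insert (b, a) {(x, y). {x, y} \<in> E})"
    by (auto simp: doubleton_eq_iff)
  hence "conn (insert {a, b} E) = (insert (a, b) (insert (b, a) {(x, y). {x, y} \<in> E}))\<^sup>*"
    by (simp add: conn_def)
  also have "(x, y) \<in> \<dots> \<longleftrightarrow>
     (x, y) \<in> conn E \<or> (x, a) \<in> conn E \<and> (b, y) \<in> conn E \<or> (x, b) \<in> conn E \<and> (a, y) \<in> conn E"
    unfolding rtrancl_insert conn_def[symmetric] Un_iff mem_Collect_eq case_prod_conv
    using conn_trans[of x a E y] conn_trans[of x b E y] by auto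
  finally show ?thesis .
qed

definition part :: "'a set set \<Rightarrow> 'a \<Rightarrow> 'a set" where
  "part E x = {y. (x, y) \<in> conn E}"

lemma self_in_part [simp]: "x \<in> part E x"
  by (simp add: part_def)

lemma part_eq_iff: "part E x = part E y \<longleftrightarrow> (x, y) \<in> conn E"
proof
  assume "part E x = part E y"
  hence "y \<in> part E x" by simp
  thus "(x, y) \<in> conn E" by (simp add: part_def)
next
  assume "(x, y) \<in> conn E"
  note xy = this
  show "part E x = part E y"
    unfolding part_def
  proof (rule Collect_cong)
    fix z
    show "(x, z) \<in> conn E \<longleftrightarrow> (y, z) \<in> conn E"
      using conn_trans[OF xy, of z] conn_trans[OF conn_sym[OF xy], of z] by blast
  qed
qed

lemma part_eqI: "y \<in> part E x \<Longrightarrow> part E y = part E x"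
  unfolding part_eq_iff by (simp add: part_def conn_commute[of y])

lemma part_insert:
  "part (insert {a, b} E) x =
     (if x \<in> part E a \<union> part E b then part E a \<union> part E b else part E x)"
proof (rule set_eqI)
  fix y
  have mem: "y \<in> part (insert {a, b} E) x \<longleftrightarrow>
      y \<in> part E x \<or> x \<in> part E a \<and> y \<in> part E b \<or> x \<in> part E b \<and> y \<in> part E a"
    by (simp add: part_def conn_insert_iff conn_commute[of x a] conn_commute[of x b])
  show "y \<in> part (insert {a, b} E) x \<longleftrightarrow>
    y \<in> (if x \<in> part E a \<union> part E b then part E a \<union> part E b else part E x)" (is ?thesis)
  proof (cases "x \<in> part E a"; cases "x \<in> part E b")
    assume "x \<in> part E a" "x \<notin> part E b"
    thus ?thesis using mem part_eqI[of x E a] by simp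
  next
    assume "x \<notin> part E a" "x \<in> part E b"
    thus ?thesis using mem part_eqI[of x E b] by (simp add: disj_commute)
  next
    assume "x \<in> part E a" "x \<in> part E b"
    thus ?thesis using mem part_eqI[of x E a] part_eqI[of x E b] by simp
  qed (use mem in simp)
qed

definition edges :: "'a set \<Rightarrow> 'a set set" where
  "edges V = {e. e \<subseteq> V \<and> card e = 2}"

lemma edgesE:
  assumes "e \<in> edges V"
  obtains a b where "e = {a, b}" "a \<noteq> b" "a \<in> V" "b \<in> V"
  using assms unfolding edges_def card_2_iff by blast

lemma doubleton_in_edges [simp]: "{a, b} \<in> edges V \<longleftrightarrow> a \<in> V \<and> b \<in> V \<and> a \<noteq> b"
  by (auto simp: edges_def card_2_iff doubleton_eq_iff)

lemma finite_edges: "finite V \<Longrightarrow> finite (edges V)"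
  by (simp add: edges_def)

lemma part_subset:
  assumes "E \<subseteq> edges V" "x \<in> V"
  shows "part E x \<subseteq> V"
proof
  fix y assume "y \<in> part E x"
  hence "(x, y) \<in> {(a, b). {a, b} \<in> E}\<^sup>*" by (simp add: part_def conn_def)
  thus "y \<in> V" by (induction rule: rtrancl_induct) (use assms in auto)
qed

text \<open>
  Acyclicity in the form that every edge is a bridge. This is independent of any order of the
  edges and is inherited by subsets; a singleton \<open>{a}\<close> is never an edge of a forest, since
  \<open>a\<close> is connected with itself.
\<close>

definition forest :: "'a set set \<Rightarrow> bool" where
  "forest E \<longleftrightarrow> (\<forall>a b. {a, b} \<in> E \<longrightarrow> (a, b) \<notin> conn (E - {{a, b}}))"

lemma forest_empty [simp]: "forest {}"
  by (simp add: forest_def)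

lemma forest_subset: "forest E \<Longrightarrow> E' \<subseteq> E \<Longrightarrow> forest E'"
  unfolding forest_def by (meson Diff_mono conn_mono in_mono order_refl)

text \<open>
  The nontrivial direction is the exchange property of the graphic matroid: if the new edge
  \<open>{a, b}\<close> closed a cycle through an old edge \<open>{x, y}\<close>, then \<open>a\<close> and \<open>b\<close> would already be connected
  by means of \<open>{x, y}\<close>.
\<close>

lemma forest_insert:
  assumes "{a, b} \<notin> E"
  shows "forest (insert {a, b} E) \<longleftrightarrow> forest E \<and> (a, b) \<notin> conn E"
proof (intro iffI conjI)
  assume F: "forest (insert {a, b} E)"
  thus "forest E" by (rule forest_subset) auto
  show "(a, b) \<notin> conn E"
    using F[unfolded forest_def, rule_format, of a b] assms by simp
next
  assume F: "forest E \<and> (a, b) \<notin> conn E"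
  show "forest (insert {a, b} E)"
    unfolding forest_def
  proof (intro allI impI)
    fix x y assume xy: "{x, y} \<in> insert {a, b} E"
    show "(x, y) \<notin> conn (insert {a, b} E - {{x, y}})"
    proof (cases "{x, y} = {a, b}")
      case True
      hence "insert {a, b} E - {{x, y}} = E" using assms by simp
      moreover have "x = a \<and> y = b \<or> x = b \<and> y = a"
        using True unfolding doubleton_eq_iff .
      ultimately show ?thesis using F conn_sym[of b a E] by auto
    next
      case False
      define E0 where "E0 = E - {{x, y}}"
      have eq: "insert {a, b} E - {{x, y}} = insert {a, b} E0" "E = insert {x, y} E0"
        using False xy by (simp_all add: E0_def insert_Diff_if insert_absorb)
      have "{x, y} \<in> E" using False xy by simp
      hence "(x, y) \<notin> conn E0" using F by (simp add: forest_def E0_def)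
      moreover have "(a, b) \<notin> conn (insert {x, y} E0)" using F eq by simp
      ultimately show ?thesis
        unfolding eq(1) conn_insert_iff
        using conn_sym[of x a E0] conn_sym[of b y E0] by blast
    qed
  qed
qed

definition forests :: "'a set \<Rightarrow> nat \<Rightarrow> 'a set set set" where
  "forests V t = {E. E \<subseteq> edges V \<and> card E = t \<and> forest E}"

lemma finite_forests: "finite V \<Longrightarrow> finite (forests V t)"
  by (rule finite_subset[of _ "Pow (edges V)"]) (auto simp: forests_def finite_edges)

definition parts :: "'a set \<Rightarrow> 'a set set \<Rightarrow> 'a set set" where
  "parts V E = part E ` V"

lemma parts_insert:
  assumes "a \<in> V" "b \<in> V" "(a, b) \<notin> conn E"
  shows "parts V (insert {a, b} E) =
           insert (part E a \<union> part E b) (parts V E - {part E a, part E b})"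
proof -
  define M where "M = part E a \<union> part E b"
  have iff: "part E x = part E a \<or> part E x = part E b \<longleftrightarrow> x \<in> M" for x
  proof
    assume "part E x = part E a \<or> part E x = part E b"
    moreover have "x \<in> part E x" by simp
    ultimately show "x \<in> M" unfolding M_def by blast
  next
    assume "x \<in> M"
    thus "part E x = part E a \<or> part E x = part E b"
      using part_eqI[of x E a] part_eqI[of x E b] unfolding M_def by blast
  qed
  have "parts V (insert {a, b} E) = (\<lambda>x. if x \<in> M then M else part E x) ` V"
    by (simp add: parts_def part_insert M_def)
  also have "\<dots> = (\<lambda>x. if x \<in> M then M else part E x) ` {x \<in> V. x \<in> M}
      \<union> (\<lambda>x. if x \<in> M then M else part E x) ` {x \<in> V. x \<notin> M}"
    by (subst image_Un[symmetric], rule arg_cong[of V]) blast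
  also have "(\<lambda>x. if x \<in> M then M else part E x) ` {x \<in> V. x \<in> M} = {M}"
  proof -
    have "a \<in> M" by (simp add: M_def)
    thus ?thesis using assms(1) by force
  qed
  also have "(\<lambda>x. if x \<in> M then M else part E x) ` {x \<in> V. x \<notin> M} =
      part E ` {x \<in> V. x \<notin> M}"
    by (intro image_cong) simp_all
  also have "part E ` {x \<in> V. x \<notin> M} = part E ` {x \<in> V. \<not> (part E x = part E a \<or> part E x = part E b)}"
    by (simp only: iff)
  also have "\<dots> = parts V E - {part E a, part E b}"
    by (auto simp: parts_def)
  finally show ?thesis by (simp only: M_def insert_is_Un[symmetric])
qed

lemma merged_part_new:
  assumes "(a, b) \<notin> conn E"
  shows "part E a \<union> part E b \<notin> parts V E"
proof
  assume "part E a \<union> part E b \<in> parts V E"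
  then obtain x where x: "part E a \<union> part E b = part E x" unfolding parts_def by (rule imageE)
  have "a \<in> part E a \<union> part E b" "b \<in> part E a \<union> part E b" by simp_all
  hence "a \<in> part E x" "b \<in> part E x" unfolding x .
  hence "part E a = part E b" using part_eqI[of a E x] part_eqI[of b E x] by simp
  thus False using assms by (simp add: part_eq_iff)
qed

text \<open>
  Each edge of a forest merges two components, so it lowers their number by one.
\<close>

lemma card_parts:
  assumes "finite V" "E \<subseteq> edges V" "forest E"
  shows "card (parts V E) + card E = card V"
proof -
  have "finite E" by (rule finite_subset[OF assms(2) finite_edges[OF assms(1)]])
  thus ?thesis using assms(2,3)
  proof (induction rule: finite_induct)
    case empty
    have "part {} x = {x}" for x :: 'a by (simp add: part_def conn_def)
    thus ?case by (simp add: parts_def card_image)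
  next
    case (insert e E)
    hence "e \<in> edges V" by simp
    then obtain a b where e: "e = {a, b}" "a \<noteq> b" "a \<in> V" "b \<in> V"
      by (rule edgesE)
    have F: "forest E" "(a, b) \<notin> conn E"
      using insert(2,5) forest_insert[of a b E] unfolding e(1) by simp_all
    have IH: "card (parts V E) + card E = card V" using insert F by auto
    have fin: "finite (parts V E)" using assms by (simp add: parts_def)
    have in_parts: "part E a \<in> parts V E" "part E b \<in> parts V E"
      using e(3,4) by (simp_all add: parts_def)
    have neq: "part E a \<noteq> part E b" using F(2) by (simp add: part_eq_iff)
    have two: "card (parts V E) \<ge> 2"
      using card_mono[OF fin, of "{part E a, part E b}"] in_parts neq by simp
    have "card (parts V (insert e E)) = Suc (card (parts V E - {part E a, part E b}))"
      unfolding e(1) parts_insert[OF e(3,4) F(2)]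
      using fin merged_part_new[OF F(2), of V] by (subst card_insert_disjoint) simp_all
    also have "card (parts V E - {part E a, part E b}) = card (parts V E) - 2"
      using in_parts neq by (subst card_Diff_subset) simp_all
    finally show ?case using IH two insert(1,2) by simp
  qed
qed

text \<open>
  The number of ways to choose a root in every component. Counting rooted forests instead of forests
  makes the sum over all possible additional edges computable (\<open>sum_rootings_links\<close>).
\<close>

definition rootings :: "'a set \<Rightarrow> 'a set set \<Rightarrow> real" where
  "rootings V E = (\<Prod>C\<in>parts V E. real (card C))"

lemma rootings_insert:
  assumes V: "finite V" "E \<subseteq> edges V" and ab: "a \<in> V" "b \<in> V" "(a, b) \<notin> conn E"
  shows "rootings V (insert {a, b} E) =
           rootings V E * (1 / real (card (part E a)) + 1 / real (card (part E b)))"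
proof -
  have fin: "finite (parts V E)" using V by (simp add: parts_def)
  have fp: "finite (part E a)" "finite (part E b)"
    using part_subset[OF V(2)] ab(1,2) finite_subset[OF _ V(1)] by simp_all
  have pos: "card (part E a) > 0" "card (part E b) > 0"
    using fp by (auto simp: card_gt_0_iff intro: self_in_part)
  have ne: "part E a \<noteq> part E b" using ab by (simp add: part_eq_iff)
  have disj: "part E a \<inter> part E b = {}"
  proof (rule ccontr)
    assume "\<not> ?thesis"
    then obtain x where "x \<in> part E a" "x \<in> part E b" by auto
    thus False using part_eqI[of x E a] part_eqI[of x E b] ne by simp
  qed
  define P where "P = (\<Prod>C\<in>parts V E - {part E a, part E b}. real (card C))"
  have "parts V E = insert (part E a) (insert (part E b) (parts V E - {part E a, part E b}))"
    using ab by (auto simp: parts_def)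
  hence "rootings V E =
      prod (\<lambda>C. real (card C)) (insert (part E a) (insert (part E b) (parts V E - {part E a, part E b})))"
    unfolding rootings_def by (rule arg_cong)
  also have "\<dots> = real (card (part E a)) * (real (card (part E b)) * P)"
    using fin ne by (simp add: P_def)
  finally have 1: "rootings V E = real (card (part E a)) * (real (card (part E b)) * P)" .
  have "rootings V (insert {a, b} E) = real (card (part E a \<union> part E b)) * P"
    unfolding rootings_def parts_insert[OF ab] P_def
    using fin merged_part_new[OF ab(3), of V] by (subst prod.insert) auto
  also have "card (part E a \<union> part E b) = card (part E a) + card (part E b)"
    using fp disj by (rule card_Un_disjoint)
  finally show ?thesis using pos by (simp add: 1 field_simps)
qed

text \<open>
  The edges that can be added to a forest so that it remains a forest.
\<close>

definition links :: "'a set \<Rightarrow> 'a set set \<Rightarrow> 'a set set" where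
  "links V E = {{a, b} | a b. a \<in> V \<and> b \<in> V \<and> (a, b) \<notin> conn E}"

lemma links_subset: "links V E \<subseteq> edges V"
  by (auto simp: links_def)

text \<open>
  Pairs of a forest with \<open>s + 1\<close> edges and one of its edges correspond to pairs of a forest with
  \<open>s\<close> edges and a link of it.
\<close>

lemma sum_forests_Suc:
  assumes V: "finite V"
  shows "(\<Sum>E\<in>forests V (Suc s). real (Suc s) * g E) =
           (\<Sum>E\<in>forests V s. \<Sum>e\<in>links V E. g (insert e E))"
proof -
  have fin: "finite E" if "E \<in> forests V t" for E t
    using that finite_subset[OF _ finite_edges[OF V]] by (auto simp: forests_def)
  have finl: "finite (links V E)" for E
    using finite_subset[OF links_subset finite_edges[OF V]] .
  have "(\<Sum>E\<in>forests V (Suc s). real (Suc s) * g E) = (\<Sum>E\<in>forests V (Suc s). \<Sum>e\<in>E. g E)"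
    by (intro sum.cong) (auto simp: forests_def)
  also have "\<dots> = (\<Sum>(E, e)\<in>Sigma (forests V (Suc s)) (\<lambda>E. E). g E)"
    using fin by (intro sum.Sigma) (auto simp: finite_forests V)
  also have "\<dots> = (\<Sum>(E, e)\<in>Sigma (forests V s) (links V). g (insert e E))"
  proof (rule sum.reindex_bij_witness[where i = "\<lambda>(E, e). (insert e E, e)" and j = "\<lambda>(E, e). (E - {e}, e)"];
      clarify)
    fix E e assume E: "E \<in> forests V (Suc s)" "e \<in> E"
    then obtain a b where e: "e = {a, b}" "a \<noteq> b" "a \<in> V" "b \<in> V"
      using edgesE[of e V] unfolding forests_def by blast
    have ins: "insert e (E - {e}) = E" using E by auto
    have "forest (E - {e}) \<and> (a, b) \<notin> conn (E - {e})"
      using forest_insert[of a b "E - {e}"] E ins e by (auto simp: forests_def)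
    thus "E - {e} \<in> forests V s \<and> e \<in> links V (E - {e})"
      using E e fin[OF E(1)] by (auto simp: forests_def links_def)
    show "insert e (E - {e}) = E \<and> e = e" using ins by simp
    show "g (insert e (E - {e})) = g E" using ins by simp
  next
    fix E e assume E: "E \<in> forests V s" "e \<in> links V E"
    then obtain a b where e: "e = {a, b}" "a \<in> V" "b \<in> V" "(a, b) \<notin> conn E"
      by (auto simp: links_def)
    have "e \<notin> E" using e by (auto simp: conn_def)
    thus "insert e E \<in> forests V (Suc s) \<and> e \<in> insert e E"
      using E e fin[OF E(1)] forest_insert[of a b E] by (auto simp: forests_def)
    show "insert e E - {e} = E \<and> e = e" using \<open>e \<notin> E\<close> by auto
  qed
  also have "\<dots> = (\<Sum>E\<in>forests V s. \<Sum>e\<in>links V E. g (insert e E))"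
    using finl by (intro sum.Sigma[symmetric]) (auto simp: finite_forests V)
  finally show ?thesis .
qed

text \<open>
  Joining the components of \<open>a\<close> and \<open>b\<close> multiplies the number of rootings by
  \<open>1 / |C\<^sub>a| + 1 / |C\<^sub>b|\<close>. Summed over all ordered pairs in different components, the reciprocals of
  the component sizes give \<open>n\<close> times the number of components other than a given one. So the sum
  depends on the forest only through its weight and the number of its components.
\<close>

lemma sum_rootings_links:
  assumes V: "finite V" "E \<subseteq> edges V"
  shows "(\<Sum>e\<in>links V E. rootings V (insert e E)) =
           rootings V E * (real (card V) * (real (card (parts V E)) - 1))"
proof -
  define q where "q = (\<lambda>x. 1 / real (card (part E x)))"
  have finl: "finite (links V E)"
    using finite_subset[OF links_subset finite_edges[OF V(1)]] .
  have sub: "part E x \<subseteq> V" if "x \<in> V" for x using part_subset[OF V(2) that] .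
  have pos: "card (part E x) > 0" if "x \<in> V" for x
    using finite_subset[OF sub[OF that] V(1)] by (auto simp: card_gt_0_iff intro: self_in_part)
  have "(\<Sum>e\<in>links V E. rootings V (insert e E)) = (\<Sum>e\<in>links V E. rootings V E * (\<Sum>x\<in>{x\<in>V. x \<in> e}. q x))"
  proof (rule sum.cong)
    fix e assume "e \<in> links V E"
    then obtain a b where e: "e = {a, b}" "a \<in> V" "b \<in> V" "(a, b) \<notin> conn E"
      by (auto simp: links_def)
    have "a \<noteq> b" using e(4) by auto
    moreover have "{x\<in>V. x \<in> e} = {a, b}" using e(1-3) by auto
    ultimately show "rootings V (insert e E) = rootings V E * (\<Sum>x\<in>{x\<in>V. x \<in> e}. q x)"
      using rootings_insert[OF V e(2-4)] e(1) by (simp add: q_def)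
  qed simp
  also have "\<dots> = rootings V E * (\<Sum>e\<in>links V E. \<Sum>x\<in>{x\<in>V. x \<in> e}. q x)"
    by (simp add: sum_distrib_left)
  also have "(\<Sum>e\<in>links V E. \<Sum>x\<in>{x\<in>V. x \<in> e}. q x) = (\<Sum>x\<in>V. \<Sum>e\<in>{e\<in>links V E. x \<in> e}. q x)"
    by (rule sum.swap_restrict[OF finl V(1)])
  also have "\<dots> = (\<Sum>x\<in>V. real (card V) * q x - 1)"
  proof (rule sum.cong)
    fix x assume x: "x \<in> V"
    have "{e\<in>links V E. x \<in> e} = (\<lambda>y. {x, y}) ` (V - part E x)"
    proof (intro subset_antisym subsetI)
      fix e assume "e \<in> {e\<in>links V E. x \<in> e}"
      then obtain a b where e: "e = {a, b}" "a \<in> V" "b \<in> V" "(a, b) \<notin> conn E" "x = a \<or> x = b"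
        by (auto simp: links_def)
      have "(b, a) \<notin> conn E" using e(4) conn_sym[of b a E] by auto
      hence "a \<in> V - part E b" "b \<in> V - part E a" using e by (simp_all add: part_def)
      thus "e \<in> (\<lambda>y. {x, y}) ` (V - part E x)" using e(1,5) by auto
    next
      fix e assume "e \<in> (\<lambda>y. {x, y}) ` (V - part E x)"
      thus "e \<in> {e\<in>links V E. x \<in> e}" using x by (auto simp: links_def part_def)
    qed
    moreover have "inj_on (\<lambda>y. {x, y}) (V - part E x)"
      by (auto simp: inj_on_def doubleton_eq_iff)
    ultimately have "card {e\<in>links V E. x \<in> e} = card (V - part E x)"
      by (simp add: card_image)
    also have "\<dots> = card V - card (part E x)"
      using sub[OF x] finite_subset[OF _ V(1)] by (intro card_Diff_subset) simp_all
    finally have "card {e\<in>links V E. x \<in> e} = card V - card (part E x)" .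
    thus "(\<Sum>e\<in>{e\<in>links V E. x \<in> e}. q x) = real (card V) * q x - 1"
      using pos[OF x] card_mono[OF V(1) sub[OF x]] by (simp add: q_def of_nat_diff field_simps)
  qed simp
  also have "\<dots> = real (card V) * (\<Sum>x\<in>V. q x) - real (card V)"
    by (simp add: sum_subtractf sum_distrib_left)
  also have "(\<Sum>x\<in>V. q x) = (\<Sum>C\<in>part E ` V. \<Sum>x\<in>{x\<in>V. part E x = C}. q x)"
    using V by (intro sum.image_gen)
  also have "\<dots> = (\<Sum>C\<in>part E ` V. 1)"
  proof (rule sum.cong)
    fix C assume "C \<in> part E ` V"
    then obtain y where y: "y \<in> V" "C = part E y" by auto
    have q: "q x = 1 / real (card C)" if "x \<in> C" for x
      using part_eqI[of x E y] that y(2) by (simp add: q_def)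
    have "{x\<in>V. part E x = C} = C"
    proof (intro subset_antisym subsetI)
      fix x assume "x \<in> {x\<in>V. part E x = C}"
      hence "part E x = C" by simp
      thus "x \<in> C" using self_in_part[of x E] by (simp only:)
    next
      fix x assume "x \<in> C"
      thus "x \<in> {x\<in>V. part E x = C}"
        using subsetD[OF sub[OF y(1)], of x] part_eqI[of x E y] y(2) by simp
    qed
    thus "(\<Sum>x\<in>{x\<in>V. part E x = C}. q x) = 1"
      using pos[OF y(1)] y(2) by (simp add: q)
  qed simp
  finally show ?thesis by (simp add: parts_def algebra_simps)
qed

text \<open>
  The two preceding lemmas give \<open>(s + 1) R(s + 1) = n (n - s - 1) R(s)\<close> for the number \<open>R(s)\<close> of
  rooted forests with \<open>s\<close> edges.
\<close>

lemma sum_rootings_forests: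
  assumes V: "finite V" and "s < card V"
  shows "(\<Sum>E\<in>forests V s. rootings V E) = real (card V) ^ s * real ((card V - 1) choose s)"
  using assms(2)
proof (induction s)
  case 0
  have "forests V 0 = {{}}"
    using finite_edges[OF V] by (auto simp: forests_def card_eq_0_iff dest: finite_subset)
  moreover have "part {} x = {x}" for x :: 'a by (simp add: part_def conn_def)
  ultimately show ?case by (simp add: rootings_def parts_def prod.reindex)
next
  case (Suc s)
  define n where "n = card V"
  have "real (Suc s) * (\<Sum>E\<in>forests V (Suc s). rootings V E) =
      (\<Sum>E\<in>forests V s. \<Sum>e\<in>links V E. rootings V (insert e E))"
    using sum_forests_Suc[OF V, of s "rootings V"] by (simp add: sum_distrib_left)
  also have "\<dots> = (\<Sum>E\<in>forests V s. rootings V E * (real n * real (n - 1 - s)))"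
  proof (rule sum.cong)
    fix E assume E: "E \<in> forests V s"
    hence "card (parts V E) + s = n" using card_parts[OF V, of E] by (auto simp: forests_def n_def)
    hence "real (card (parts V E)) - 1 = real (n - 1 - s)" using Suc.prems by (simp add: n_def of_nat_diff)
    thus "(\<Sum>e\<in>links V E. rootings V (insert e E)) = rootings V E * (real n * real (n - 1 - s))"
      using E sum_rootings_links[OF V, of E] by (simp add: forests_def n_def)
  qed simp
  also have "\<dots> = real n ^ Suc s * (real (n - 1 - s) * real ((n - 1) choose s))"
    using Suc by (simp add: n_def flip: sum_distrib_right)
  also have "real (n - 1 - s) * real ((n - 1) choose s) = real (Suc s) * real ((n - 1) choose Suc s)"
  proof -
    have "(n - 1 - s) * ((n - 1) choose s) = Suc s * ((n - 1) choose Suc s)"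
      by (simp only: binomial_absorb_comp binomial_absorption)
    thus ?thesis unfolding of_nat_mult[symmetric] by (rule arg_cong)
  qed
  finally show ?case by (simp add: n_def)
qed

text \<open>
  Cayley's formula: a tree on \<open>n\<close> vertices has \<open>n\<close> rootings, and there are \<open>n\<^bsup>n-1\<^esup>\<close> rooted trees.
\<close>

theorem card_spanning_trees:
  assumes V: "finite V" "V \<noteq> {}"
  shows "card (forests V (card V - 1)) = card V ^ (card V - 2)"
proof -
  define n where "n = card V"
  have n: "n > 0" using V by (simp add: n_def card_gt_0_iff)
  have "rootings V E = real n" if E: "E \<in> forests V (n - 1)" for E
  proof -
    have "card (parts V E) = 1"
      using card_parts[of V E] E V n by (auto simp: forests_def n_def)
    then obtain C where C: "parts V E = {C}" by (auto simp: card_1_singleton_iff)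
    have "C = V"
    proof
      have "C \<in> parts V E" using C by simp
      then obtain v where "v \<in> V" "C = part E v" unfolding parts_def by blast
      thus "C \<subseteq> V" using part_subset[of E V v] E by (simp add: forests_def)
      show "V \<subseteq> C"
      proof
        fix x assume "x \<in> V"
        hence "part E x \<in> parts V E" by (simp add: parts_def)
        thus "x \<in> C" using C self_in_part[of x E] by (simp only: singleton_iff)
      qed
    qed
    thus ?thesis by (simp add: rootings_def C n_def)
  qed
  hence "real (card (forests V (n - 1))) * real n = real n ^ (n - 1)"
    using sum_rootings_forests[OF V(1), of "n - 1"] n by (simp add: n_def)
  hence "card (forests V (n - 1)) * n = n ^ (n - 1)"
    by (simp flip: of_nat_mult of_nat_power)
  also have "n ^ (n - 1) = n ^ (n - 2) * n"
    using n by (cases "n = 1") (auto simp: Suc_diff_Suc numeral_2_eq_2 simp flip: power_Suc2)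
  finally show ?thesis using n by (simp add: n_def)
qed

text \<open>
  A path that starts in a set of vertices which no edge leaves uses only edges inside that set.
\<close>

lemma conn_restrict:
  assumes "\<And>e. e \<in> E \<Longrightarrow> e \<subseteq> B \<or> e \<inter> B = {}" "x \<in> B"
  shows "(x, y) \<in> conn E \<longleftrightarrow> (x, y) \<in> conn {e \<in> E. e \<subseteq> B}"
proof
  assume "(x, y) \<in> conn E"
  hence "(x, y) \<in> {(a, b). {a, b} \<in> E}\<^sup>*" by (simp add: conn_def)
  hence "y \<in> B \<and> (x, y) \<in> {(a, b). {a, b} \<in> {e \<in> E. e \<subseteq> B}}\<^sup>*"
  proof (induction rule: rtrancl_induct)
    case (step y z)
    hence "{y, z} \<in> E" "y \<in> B" by auto
    hence "{y, z} \<subseteq> B" using assms(1)[of "{y, z}"] by blast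
    hence "z \<in> B" "(y, z) \<in> {(a, b). {a, b} \<in> {e \<in> E. e \<subseteq> B}}"
      using \<open>{y, z} \<in> E\<close> by auto
    thus ?case using step.IH by (auto intro: rtrancl_into_rtrancl)
  qed (use assms(2) in simp)
  thus "(x, y) \<in> conn {e \<in> E. e \<subseteq> B}" by (simp add: conn_def)
next
  assume "(x, y) \<in> conn {e \<in> E. e \<subseteq> B}"
  thus "(x, y) \<in> conn E" using conn_mono[of "{e \<in> E. e \<subseteq> B}" E] by blast
qed

lemma forest_split:
  assumes "E1 \<subseteq> edges B" "E2 \<subseteq> edges (V - B)"
  shows "forest (E1 \<union> E2) \<longleftrightarrow> forest E1 \<and> forest E2"
proof (intro iffI conjI)
  assume F: "forest (E1 \<union> E2)"
  show "forest E1" "forest E2" by (rule forest_subset[OF F]; simp)+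
next
  assume F: "forest E1 \<and> forest E2"
  have sub: "e \<subseteq> B" if "e \<in> E1" for e using that assms by (auto simp: edges_def)
  have sub2: "e \<inter> B = {}" if "e \<in> E2" for e using that assms(2) unfolding edges_def by blast
  have ne: "\<not> e \<subseteq> B" if "e \<in> E2" for e
  proof
    assume "e \<subseteq> B"
    hence "e = {}" using sub2[OF that] by blast
    thus False using that assms(2) by (auto simp: edges_def)
  qed
  have ne1: "\<not> e \<subseteq> - B" if "e \<in> E1" for e
  proof
    assume "e \<subseteq> - B"
    hence "e = {}" using sub[OF that] by blast
    thus False using that assms(1) by (auto simp: edges_def)
  qed
  show "forest (E1 \<union> E2)"
    unfolding forest_def
  proof (intro allI impI)
    fix a b assume ab: "{a, b} \<in> E1 \<union> E2"
    define E where "E = E1 \<union> E2 - {{a, b}}"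
    have e1: "{e \<in> E. e \<subseteq> B} = E1 - {{a, b}}"
      using sub ne by (auto simp: E_def)
    have e2: "{e \<in> E. e \<subseteq> - B} = E2 - {{a, b}}"
    proof (intro subset_antisym subsetI)
      fix e assume "e \<in> {e \<in> E. e \<subseteq> - B}"
      thus "e \<in> E2 - {{a, b}}" using ne1[of e] by (simp add: E_def) blast
    next
      fix e assume "e \<in> E2 - {{a, b}}"
      thus "e \<in> {e \<in> E. e \<subseteq> - B}" using sub2[of e] by (simp add: E_def disjoint_eq_subset_Compl)
    qed
    show "(a, b) \<notin> conn (E1 \<union> E2 - {{a, b}})"
    proof (cases "{a, b} \<in> E1")
      case True
      have "(a, b) \<in> conn E \<longleftrightarrow> (a, b) \<in> conn {e \<in> E. e \<subseteq> B}"
        by (rule conn_restrict) (use sub sub2 sub[OF True] in \<open>simp_all add: E_def, blast\<close>)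
      thus ?thesis using F True e1 by (simp add: forest_def E_def)
    next
      case False
      hence 2: "{a, b} \<in> E2" using ab by simp
      have "(a, b) \<in> conn E \<longleftrightarrow> (a, b) \<in> conn {e \<in> E. e \<subseteq> - B}"
      proof (rule conn_restrict)
        show "a \<in> - B" using sub2[OF 2] by simp
        fix e assume "e \<in> E"
        hence "e \<in> E1 \<or> e \<in> E2" by (simp add: E_def)
        thus "e \<subseteq> - B \<or> e \<inter> - B = {}" using sub[of e] sub2[of e] by blast
      qed
      thus ?thesis using F 2 e2 by (simp add: forest_def E_def)
    qed
  qed
qed

lemma edge_conn: "{a, b} \<in> E \<Longrightarrow> (a, b) \<in> conn E"
  unfolding conn_def by (rule r_into_rtrancl) simp

text \<open>
  Both sides say that there is only one component.
\<close>

lemma spanning_tree_iff: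
  assumes B: "finite B" "v \<in> B" and E: "E \<subseteq> edges B" "forest E"
  shows "part E v = B \<longleftrightarrow> card E = card B - 1"
proof -
  have cp: "card (parts B E) + card E = card B" by (rule card_parts[OF B(1) E])
  have pv: "part E v \<in> parts B E" using B by (simp add: parts_def)
  have cB: "card B > 0" using B by (auto simp: card_gt_0_iff)
  have fin: "finite (parts B E)" using B by (simp add: parts_def)
  have "part E v = B \<longleftrightarrow> parts B E = {part E v}"
  proof
    assume v: "part E v = B"
    have "parts B E = (\<lambda>_. part E v) ` B"
      unfolding parts_def using part_eqI[of _ E v] v by (intro image_cong) blast+
    also have "\<dots> = {part E v}" using B(2) by blast
    finally show "parts B E = {part E v}" .
  next
    assume p: "parts B E = {part E v}"
    show "part E v = B"
    proof
      show "part E v \<subseteq> B" by (rule part_subset[OF E(1) B(2)])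
      show "B \<subseteq> part E v"
      proof
        fix x assume "x \<in> B"
        hence "part E x \<in> parts B E" by (simp add: parts_def)
        hence "part E x = part E v" using p by simp
        thus "x \<in> part E v" using self_in_part[of x E] by (simp only:)
      qed
    qed
  qed
  also have "\<dots> \<longleftrightarrow> card (parts B E) = 1"
    using pv by (auto simp: card_1_singleton_iff)
  also have "\<dots> \<longleftrightarrow> card E = card B - 1" using cp cB card_gt_0_iff[of "parts B E"] pv fin by auto
  finally show ?thesis .
qed

text \<open>
  A forest in which \<open>B\<close> is a component consists of a spanning tree of \<open>B\<close> and an arbitrary forest on
  the remaining vertices, and any such pair may be combined.
\<close>

lemma card_forests_with_part:
  assumes V: "finite V" and B: "B \<subseteq> V" "v \<in> B" and t: "card B - 1 \<le> t"
  shows "card {E \<in> forests V t. part E v = B} =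
           card (forests B (card B - 1)) * card (forests (V - B) (t - (card B - 1)))"
proof -
  define f where "f = (\<lambda>E. ({e \<in> E. e \<subseteq> B}, {e \<in> E. e \<subseteq> V - B}))"
  define g where "g = (\<lambda>(E1, E2). E1 \<union> E2 :: 'a set set)"
  define S where "S = {E \<in> forests V t. part E v = B}"
  define T where "T = forests B (card B - 1) \<times> forests (V - B) (t - (card B - 1))"
  have finB: "finite B" by (rule finite_subset[OF B(1) V])
  have fin: "finite E" if "E \<subseteq> edges V" for E
    by (rule finite_subset[OF that finite_edges[OF V]])
  have edges_B: "edges B \<subseteq> edges V" "edges (V - B) \<subseteq> edges V"
    using B by (auto simp: edges_def)
  have disj: "\<not> (e \<subseteq> B \<and> e \<subseteq> V - B)" if "e \<in> edges V" for e
  proof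
    assume "e \<subseteq> B \<and> e \<subseteq> V - B"
    hence "e = {}" by blast
    thus False using that by (auto simp: edges_def)
  qed
  have 1: "f E \<in> T \<and> g (f E) = E" if "E \<in> S" for E
  proof -
    have E: "E \<subseteq> edges V" "card E = t" "forest E" "part E v = B"
      using that by (auto simp: S_def forests_def)
    have split: "e \<subseteq> B \<or> e \<subseteq> V - B" if "e \<in> E" for e
    proof -
      have "e \<in> edges V" using that E(1) by blast
      then obtain a b where e: "e = {a, b}" "a \<noteq> b" "a \<in> V" "b \<in> V" by (rule edgesE)
      have "(a, b) \<in> conn E" using that e(1) edge_conn by simp
      hence "part E a = part E b" by (simp add: part_eq_iff)
      moreover have "x \<in> B \<longleftrightarrow> part E x = B" for x
        using E(4) part_eqI[of x E v] self_in_part[of x E] by metis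
      ultimately have "a \<in> B \<longleftrightarrow> b \<in> B" by simp
      thus ?thesis using e by auto
    qed
    define E1 E2 where "E1 = {e \<in> E. e \<subseteq> B}" and "E2 = {e \<in> E. e \<subseteq> V - B}"
    have un: "E1 \<union> E2 = E" using split by (auto simp: E1_def E2_def)
    have E12: "E1 \<subseteq> edges B" "E2 \<subseteq> edges (V - B)"
      using E(1) by (auto simp: E1_def E2_def edges_def)
    have F: "forest E1" "forest E2" by (rule forest_subset[OF E(3)]; use un in blast)+
    have "part E1 v = part E v"
      unfolding part_def E1_def
      by (subst conn_restrict[of E B v]) (use split B in auto)
    hence c1: "card E1 = card B - 1"
      using spanning_tree_iff[OF finB B(2) E12(1) F(1)] E(4) by simp
    have "E1 \<inter> E2 = {}" using disj E(1) by (auto simp: E1_def E2_def)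
    hence "card E1 + card E2 = t"
      using card_Un_disjoint[of E1 E2] fin E12 edges_B E(2) un by (metis order.trans)
    hence c2: "card E2 = t - (card B - 1)" using c1 by simp
    show ?thesis
      using E12 F c1 c2 un by (simp add: T_def f_def g_def forests_def flip: E1_def E2_def)
  qed
  have 2: "g p \<in> S \<and> f (g p) = p" if "p \<in> T" for p
  proof -
    obtain E1 E2 where p: "p = (E1, E2)" by (cases p)
    have E1: "E1 \<subseteq> edges B" "card E1 = card B - 1" "forest E1"
      and E2: "E2 \<subseteq> edges (V - B)" "card E2 = t - (card B - 1)" "forest E2"
      using that by (auto simp: T_def forests_def p)
    have E1V: "E1 \<subseteq> edges V" "E2 \<subseteq> edges V" using E1(1) E2(1) edges_B by auto
    have s1: "e \<subseteq> B" "\<not> e \<subseteq> V - B" if "e \<in> E1" for e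
    proof -
      show 1: "e \<subseteq> B" using that E1(1) by (auto simp: edges_def)
      show "\<not> e \<subseteq> V - B" using disj[of e] that E1V(1) 1 by auto
    qed
    have s2: "e \<subseteq> V - B" "\<not> e \<subseteq> B" if "e \<in> E2" for e
    proof -
      show 1: "e \<subseteq> V - B" using that E2(1) unfolding edges_def by blast
      show "\<not> e \<subseteq> B" using disj[of e] that E1V(2) 1 by auto
    qed
    have f: "{e \<in> E1 \<union> E2. e \<subseteq> B} = E1" "{e \<in> E1 \<union> E2. e \<subseteq> V - B} = E2"
      unfolding set_eq_iff mem_Collect_eq Un_iff using s1 s2 by metis+
    have "E1 \<inter> E2 = {}" using s1(1) s2(2) by blast
    hence c: "card (E1 \<union> E2) = t"
      using card_Un_disjoint[of E1 E2] fin[OF E1V(1)] fin[OF E1V(2)] E1(2) E2(2) t by simp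
    have s: "e \<subseteq> B \<or> e \<inter> B = {}" if "e \<in> E1 \<union> E2" for e
      using s1(1)[of e] s2(1)[of e] that by blast
    have "part (E1 \<union> E2) v = part E1 v"
      unfolding part_def using conn_restrict[of "E1 \<union> E2" B v, OF s B(2)] f(1) by simp
    also have "\<dots> = B" using spanning_tree_iff[OF finB B(2) E1(1,3)] E1(2) by simp
    finally show ?thesis
      using c E1 E2 E1V forest_split[OF E1(1) E2(1)] f
      by (simp add: S_def forests_def g_def f_def p)
  qed
  have "bij_betw f S T"
    by (rule bij_betw_byWitness[of S g f T]) (use 1 2 in auto)
  hence "card S = card T" by (rule bij_betw_same_card)
  thus ?thesis by (simp add: S_def T_def card_cartesian_product)
qed

text \<open>
  The hypothesis on \<open>q\<close> says that the number of forests on the remaining vertices depends only on how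
  many vertices remain. In \<open>card_forests\<close> this is supplied by the induction.
\<close>

lemma card_forests_with_part_size:
  assumes V: "finite V" "v \<in> V" and k: "1 \<le> k" "k - 1 \<le> t"
    and rest: "\<And>W. W \<subseteq> V \<Longrightarrow> card W = card V - k \<Longrightarrow> card (forests W (t - (k - 1))) = q"
  shows "card {E \<in> forests V t. card (part E v) = k} = ((card V - 1) choose (k - 1)) * k ^ (k - 2) * q"
proof -
  define \<B> where "\<B> = {B. B \<subseteq> V \<and> v \<in> B \<and> card B = k}"
  have fin\<B>: "finite \<B>" using V by (simp add: \<B>_def)
  have finB: "finite B" if "B \<in> \<B>" for B
    using that finite_subset[OF _ V(1)] by (simp add: \<B>_def)
  have "{E \<in> forests V t. card (part E v) = k} = (\<Union>B\<in>\<B>. {E \<in> forests V t. part E v = B})"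
    using part_subset[of _ V v] V(2) by (auto simp: \<B>_def forests_def)
  also have "card \<dots> = (\<Sum>B\<in>\<B>. card {E \<in> forests V t. part E v = B})"
    using fin\<B> finite_forests[OF V(1)] by (intro card_UN_disjoint) auto
  also have "\<dots> = (\<Sum>B\<in>\<B>. k ^ (k - 2) * q)"
  proof (rule sum.cong)
    fix B assume B: "B \<in> \<B>"
    have "card (V - B) = card V - k"
      using B finB[OF B] by (simp add: \<B>_def card_Diff_subset)
    hence "card (forests (V - B) (t - (k - 1))) = q" by (intro rest) auto
    moreover have "card (forests B (k - 1)) = k ^ (k - 2)"
      using card_spanning_trees[OF finB[OF B]] B by (auto simp: \<B>_def)
    ultimately show "card {E \<in> forests V t. part E v = B} = k ^ (k - 2) * q"
      using card_forests_with_part[OF V(1), of B v t] B k by (simp add: \<B>_def)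
  qed simp
  also have "\<dots> = card \<B> * (k ^ (k - 2) * q)" by simp
  also have "card \<B> = (card V - 1) choose (k - 1)"
  proof -
    have "bij_betw (insert v) {B. B \<subseteq> V - {v} \<and> card B = k - 1} \<B>"
    proof (rule bij_betw_byWitness[of _ "\<lambda>B. B - {v}"])
      show "insert v ` {B. B \<subseteq> V - {v} \<and> card B = k - 1} \<subseteq> \<B>"
      proof
        fix C assume "C \<in> insert v ` {B. B \<subseteq> V - {v} \<and> card B = k - 1}"
        then obtain B where B: "C = insert v B" "B \<subseteq> V - {v}" "card B = k - 1" by blast
        have "finite B" "v \<notin> B" using B(2) finite_subset[of B V] V by auto
        thus "C \<in> \<B>" using B V(2) k by (auto simp: \<B>_def)
      qed
      show "(\<lambda>B. B - {v}) ` \<B> \<subseteq> {B. B \<subseteq> V - {v} \<and> card B = k - 1}"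
        by (auto simp: \<B>_def)
    qed (auto simp: \<B>_def)
    hence "card \<B> = card {B. B \<subseteq> V - {v} \<and> card B = k - 1}"
      by (simp add: bij_betw_same_card)
    also have "\<dots> = (card V - 1) choose (k - 1)"
      using V n_subsets[of "V - {v}" "k - 1"] by simp
    finally show ?thesis .
  qed
  finally show ?thesis by (simp add: mult.assoc)
qed

section \<open>The tree function\<close>

text \<open>
  The \<open>n\<close>-th finite difference of \<open>x\<^bsup>j\<^esup>\<close> vanishes for \<open>j < n\<close>. Up to the factor \<open>j!\<close>, the sum is the
  \<open>j\<close>-th coefficient of \<open>(1 - exp x)\<^bsup>n\<^esup>\<close>, a series that starts with \<open>x\<^bsup>n\<^esup>\<close>.
\<close>

lemma alternating_binomial_power_sum:
  assumes "j < n"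
  shows "(\<Sum>k\<le>n. of_nat (n choose k) * (- 1) ^ k * of_nat k ^ j) = (0 :: real)"
proof -
  have "fps_nth ((1 - fps_exp (1::real)) ^ n) j = 0"
  proof (rule startsby_zero_power_prefix[rule_format])
    show "fps_nth (1 - fps_exp (1::real)) 0 = 0" by simp
    show "j < n" by fact
  qed
  also have "(1 - fps_exp (1::real)) ^ n = (- fps_exp 1 + 1) ^ n" by simp
  also have "\<dots> = (\<Sum>k\<le>n. of_nat (n choose k) * (- fps_exp (1::real)) ^ k)"
    by (subst binomial_ring) simp
  also have "\<dots> = (\<Sum>k\<le>n. fps_const (of_nat (n choose k) * (- 1) ^ k) * fps_exp (of_nat k))"
  proof (rule sum.cong)
    fix k
    have "(- fps_exp (1::real)) ^ k = fps_const ((- 1) ^ k) * fps_exp (of_nat k)"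
    proof -
      have "(- fps_exp (1::real)) ^ k = (fps_const (-1) * fps_exp 1) ^ k"
        by (simp add: fps_const_neg[symmetric] del: fps_const_neg)
      also have "\<dots> = fps_const ((- 1) ^ k) * fps_exp (of_nat k)"
        by (simp add: power_mult_distrib fps_exp_power_mult fps_const_power del: fps_const_neg) 
      finally show ?thesis .
    qed
    thus "of_nat (n choose k) * (- fps_exp (1::real)) ^ k =
        fps_const (of_nat (n choose k) * (- 1) ^ k) * fps_exp (of_nat k)"
      by (simp add: fps_of_nat[symmetric] fps_const_mult[symmetric] mult.assoc del: fps_const_mult)
  qed simp
  also have "fps_nth \<dots> j = (\<Sum>k\<le>n. of_nat (n choose k) * (- 1) ^ k * of_nat k ^ j) / fact j"
    by (simp add: fps_sum_nth sum_divide_distrib)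
  finally show ?thesis by simp
qed

text \<open>
  The exponential generating functions of unrooted and of rooted labelled trees. The empty tree is
  excluded, and the truncated exponent \<open>1 - 2 = 0\<close> gives the right value for a single vertex.
\<close>

definition tree_fps :: "real fps" where
  "tree_fps = Abs_fps (\<lambda>k. if k = 0 then 0 else real k ^ (k - 2) / fact k)"

definition rooted_tree_fps :: "real fps" where
  "rooted_tree_fps = Abs_fps (\<lambda>k. if k = 0 then 0 else real k ^ (k - 1) / fact k)"

lemma rooted_tree_fps_eq: "rooted_tree_fps = fps_X * fps_deriv tree_fps"
proof (rule fps_ext)
  fix k
  show "fps_nth rooted_tree_fps k = fps_nth (fps_X * fps_deriv tree_fps) k"
  proof (cases k)
    case (Suc l)
    show ?thesis
    proof (cases l)
      case (Suc i)
      thus ?thesis using \<open>k = Suc l\<close> by (simp add: rooted_tree_fps_def tree_fps_def)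
    qed (simp add: Suc rooted_tree_fps_def tree_fps_def)
  qed (simp add: rooted_tree_fps_def)
qed

text \<open>
  Expanding \<open>(x exp (- x))\<^bsup>k\<^esup>\<close> turns the \<open>n\<close>-th coefficient of the composition into
  an \<open>n\<close>-th finite difference of \<open>k\<^bsup>n-1\<^esup>\<close>. This states that the rooted tree series is the
  compositional inverse of \<open>x exp (- x)\<close>.
\<close>

lemma rooted_tree_fps_compose:
  "rooted_tree_fps oo (fps_X * fps_exp (- 1)) = fps_X"
proof (rule fps_ext)
  fix n
  have pw: "fps_nth ((fps_X * fps_exp (- 1)) ^ k) n = (- real k) ^ (n - k) / fact (n - k)"
    if "k \<le> n" for k
    using that by (simp add: power_mult_distrib fps_exp_power_mult fps_X_power_mult_nth)
  have "fps_nth (rooted_tree_fps oo (fps_X * fps_exp (- 1))) n =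
      (\<Sum>k=0..n. fps_nth rooted_tree_fps k * ((- real k) ^ (n - k) / fact (n - k)))"
    unfolding fps_compose_nth by (intro sum.cong) (simp_all only: pw atLeastAtMost_iff)
  also have "\<dots> = fps_nth fps_X n"
  proof (cases "n < 2")
    case True
    hence "n = 0 \<or> n = 1" by auto
    thus ?thesis by (auto simp: rooted_tree_fps_def)
  next
    case False
    have "(\<Sum>k=0..n. fps_nth rooted_tree_fps k * ((- real k) ^ (n - k) / fact (n - k))) =
      (\<Sum>k\<le>n. (-1)^n / fact n * (of_nat (n choose k) * (- 1) ^ k * of_nat k ^ (n-1)))"
    proof (rule sum.cong)
      fix k assume "k \<in> {..n}"
      hence k: "k \<le> n" by simp
      show "fps_nth rooted_tree_fps k * ((- real k) ^ (n - k) / fact (n - k)) =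
        (-1)^n / fact n * (of_nat (n choose k) * (- 1) ^ k * of_nat k ^ (n-1))"
      proof (cases "k = 0")
        case True
        thus ?thesis using False by (simp add: rooted_tree_fps_def)
      next
        case k0: False
        have 1: "(-1::real)^(n-k) = (-1)^n * (-1)^k"
          using k by (auto simp: minus_one_power_iff)
        have 2: "real k ^ (k - 1) * real k ^ (n-k) = real k ^ (n-1)"
        proof -
          have "k - 1 + (n - k) = n - 1" using k k0 by simp
          thus ?thesis by (metis power_add)
        qed
        have 3: "(- real k) ^ (n-k) = (-1)^n * (-1)^k * real k ^ (n-k)"
          by (subst power_minus) (simp add: 1)
        show ?thesis
          using k0 k 2 by (simp add: rooted_tree_fps_def binomial_fact 3 field_simps)
      qed
    qed auto
    also have "\<dots> = 0"
      using alternating_binomial_power_sum[of "n-1" n] False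
      by (subst sum_distrib_left[symmetric]) simp
    finally show ?thesis using False by simp
  qed
  finally show "fps_nth (rooted_tree_fps oo (fps_X * fps_exp (- 1))) n = fps_nth fps_X n" .
qed

text \<open>
  By the inverse property \<open>T exp (- T) = x\<close>; differentiate this, multiply by \<open>T = x U'\<close> and cancel \<open>x\<close>.
\<close>

lemma rooted_tree_fps_deriv:
  "(1 - rooted_tree_fps) * fps_deriv rooted_tree_fps = fps_deriv tree_fps"
proof -
  define W :: "real fps" where "W = fps_X * fps_exp (- 1)"
  define T where "T = rooted_tree_fps"
  have W0: "fps_nth W 0 = 0" and W1: "fps_nth W 1 \<noteq> 0" by (simp_all add: W_def)
  have T0: "fps_nth T 0 = 0" by (simp add: T_def rooted_tree_fps_def)
  have TW: "T oo W = fps_X" using rooted_tree_fps_compose by (simp add: T_def W_def)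
  have "T = (T oo W) oo fps_inv W"
    using W0 W1 fps_inv_right[OF W0 W1]
    by (subst fps_compose_assoc[symmetric]) (simp_all add: fps_inv_def)
  hence "T = fps_inv W" by (simp add: TW fps_inv_def)
  hence WT: "W oo T = fps_X" using fps_inv_right[OF W0 W1] by simp
  hence e1: "T * (fps_exp (-1) oo T) = fps_X"
    using T0 by (simp add: W_def fps_compose_mult_distrib)
  have "fps_deriv (W oo T) = 1" by (simp add: WT)
  hence "(fps_deriv W oo T) * fps_deriv T = 1" using T0 by (simp add: fps_compose_deriv)
  moreover have "fps_deriv W = (1 - fps_X) * fps_exp (-1)"
    by (simp add: W_def algebra_simps fps_const_neg[symmetric] del: fps_const_neg)
  ultimately have e2: "(1 - T) * (fps_exp (-1) oo T) * fps_deriv T = 1"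
    using T0 by (simp add: fps_compose_mult_distrib fps_compose_sub_distrib)
  have "fps_X * ((1 - T) * fps_deriv T) = T * ((1 - T) * (fps_exp (-1) oo T) * fps_deriv T)"
    by (simp add: e1[symmetric] mult_ac)
  also have "\<dots> = fps_X * fps_deriv tree_fps"
    using e2 by (simp add: T_def rooted_tree_fps_eq)
  finally show ?thesis by (simp add: T_def)
qed

text \<open>
  A tree has one more vertex than it has edges, so \<open>U\<close> is the series of vertex-rooted trees minus that
  of edge-rooted trees. Formally, both sides have the same derivative.
\<close>

lemma tree_fps_eq: "tree_fps = rooted_tree_fps - fps_const (1/2) * rooted_tree_fps ^ 2"
proof (rule fps_ext)
  fix k
  have "fps_deriv (rooted_tree_fps - fps_const (1/2) * rooted_tree_fps ^ 2) = fps_deriv tree_fps"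
    unfolding rooted_tree_fps_deriv[symmetric]
    by (simp add: fps_deriv_power power2_eq_square algebra_simps)
  thus "fps_nth tree_fps k = fps_nth (rooted_tree_fps - fps_const (1/2) * rooted_tree_fps ^ 2) k"
    unfolding fps_deriv_eq_iff by (simp add: rooted_tree_fps_def tree_fps_def power2_eq_square)
qed

lemma power_over_fact_le_exp:
  assumes "0 \<le> (x::real)"
  shows "x ^ n / fact n \<le> exp x"
proof -
  have "(\<Sum>k\<in>{n}. x ^ k /\<^sub>R fact k) \<le> (\<Sum>k. x ^ k /\<^sub>R fact k)"
    using assms summable_exp_generic[of x] by (intro sum_le_suminf) auto
  thus ?thesis by (simp add: exp_def field_simps scaleR_conv_of_real)
qed

text \<open>
  Because \<open>k\<^bsup>k\<^esup> / k! \<le> exp k\<close>, the series is dominated by a geometric one.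
\<close>

lemma tree_fps_conv_radius:
  assumes "\<bar>x\<bar> < exp (- 1)"
  shows "ereal \<bar>x\<bar> < fps_conv_radius tree_fps"
proof -
  obtain y where y: "\<bar>x\<bar> < y" "y < exp (- 1)" using assms dense by blast
  hence y0: "y > 0" by linarith
  have "summable (\<lambda>k. fps_nth tree_fps k * y ^ k)"
  proof (rule summable_comparison_test_ev)
    have "norm (exp 1 * y) < 1" using y y0 by (simp add: exp_minus field_simps)
    thus "summable (\<lambda>k. (exp 1 * y) ^ k)" by (rule summable_geometric)
    have "norm (fps_nth tree_fps k * y ^ k) \<le> (exp 1 * y) ^ k" for k
    proof (cases "k = 0")
      case False
      have "real k ^ (k - 2) / fact k \<le> real k ^ k / fact k"
        using False by (intro divide_right_mono power_increasing) auto
      also have "\<dots> \<le> exp (real k)" by (rule power_over_fact_le_exp) simp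
      also have "exp (real k) = exp 1 ^ k" by (simp add: exp_of_nat_mult[symmetric])
      finally show ?thesis
        using y0 False mult_right_mono[of _ _ "y ^ k"]
        by (fastforce simp: tree_fps_def power_mult_distrib)
    qed (simp add: tree_fps_def)
    thus "eventually (\<lambda>k. norm (fps_nth tree_fps k * y ^ k) \<le> (exp 1 * y) ^ k) sequentially"
      by simp
  qed
  hence "ereal (norm y) \<le> fps_conv_radius tree_fps"
    unfolding fps_conv_radius_def by (rule conv_radius_geI)
  moreover have "ereal \<bar>x\<bar> < ereal (norm y)" using y y0 by simp
  ultimately show ?thesis by (rule less_le_trans[rotated])
qed

lemma rooted_tree_fps_conv_radius:
  assumes "\<bar>x\<bar> < exp (- 1)"
  shows "ereal \<bar>x\<bar> < fps_conv_radius rooted_tree_fps"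
proof -
  have "fps_conv_radius tree_fps \<le> fps_conv_radius (fps_deriv tree_fps)"
    by (rule fps_conv_radius_deriv)
  also have "\<dots> \<le> fps_conv_radius rooted_tree_fps"
    using fps_conv_radius_mult[of fps_X "fps_deriv tree_fps"]
    by (simp add: rooted_tree_fps_eq)
  finally show ?thesis using tree_fps_conv_radius[OF assms] by (rule less_le_trans[rotated])
qed

lemma eval_rooted_tree_fps_eq:
  assumes "\<bar>x\<bar> < exp (- 1)"
  shows "eval_fps rooted_tree_fps x = x * eval_fps (fps_deriv tree_fps) x"
  unfolding rooted_tree_fps_eq
  using less_le_trans[OF tree_fps_conv_radius[OF assms] fps_conv_radius_deriv]
  by (subst eval_fps_mult) auto

text \<open>
  The formal identity for \<open>T'\<close> says that \<open>D = T / x\<close> satisfies \<open>D' = D T'\<close>. Hence \<open>D exp (- T)\<close> is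
  constant on the disc of convergence, with the value \<open>1\<close> at the origin.
\<close>

lemma eval_rooted_tree_fps_functional:
  assumes "\<bar>x\<bar> < exp (- 1)"
  shows "eval_fps rooted_tree_fps x = x * exp (eval_fps rooted_tree_fps x)"
proof -
  define D where "D = eval_fps (fps_deriv tree_fps)"
  define t where "t = eval_fps rooted_tree_fps"
  have DD: "fps_deriv (fps_deriv tree_fps) = fps_deriv tree_fps * fps_deriv rooted_tree_fps"
  proof -
    have 1: "fps_deriv rooted_tree_fps = fps_deriv tree_fps + fps_X * fps_deriv (fps_deriv tree_fps)"
      by (simp add: rooted_tree_fps_eq add.commute)
    have 2: "fps_deriv rooted_tree_fps - rooted_tree_fps * fps_deriv rooted_tree_fps = fps_deriv tree_fps"
      using rooted_tree_fps_deriv by (simp only: left_diff_distrib mult_1_left)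
    have "fps_X * fps_deriv (fps_deriv tree_fps) = fps_deriv rooted_tree_fps - fps_deriv tree_fps"
      unfolding 1 by simp
    also have "\<dots> = fps_deriv rooted_tree_fps -
        (fps_deriv rooted_tree_fps - rooted_tree_fps * fps_deriv rooted_tree_fps)"
      unfolding 2 ..
    also have "\<dots> = rooted_tree_fps * fps_deriv rooted_tree_fps" by simp
    also have "\<dots> = fps_X * (fps_deriv tree_fps * fps_deriv rooted_tree_fps)"
      by (simp only: rooted_tree_fps_eq mult.assoc)
    finally show ?thesis by simp
  qed
  have "\<exists>C. \<forall>y\<in>ball 0 (exp (-1)). D y * exp (- t y) = C"
  proof (rule has_field_derivative_zero_constant)
    fix y :: real assume "y \<in> ball 0 (exp (-1))"
    hence y: "\<bar>y\<bar> < exp (-1)" by simp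
    note r = tree_fps_conv_radius[OF y] rooted_tree_fps_conv_radius[OF y]
    have r1: "ereal (norm y) < fps_conv_radius (fps_deriv tree_fps)"
      using less_le_trans[OF r(1) fps_conv_radius_deriv] by simp
    have r2: "ereal (norm y) < fps_conv_radius (fps_deriv rooted_tree_fps)"
      using less_le_trans[OF r(2) fps_conv_radius_deriv] by simp
    have "(D has_field_derivative D y * eval_fps (fps_deriv rooted_tree_fps) y) (at y)"
      using has_field_derivative_eval_fps[OF r1] r1 r2 unfolding D_def DD
      by (simp add: eval_fps_mult)
    moreover have "(t has_field_derivative eval_fps (fps_deriv rooted_tree_fps) y) (at y)"
      unfolding t_def using r(2) by (intro has_field_derivative_eval_fps) simp
    ultimately have "((\<lambda>y. D y * exp (- t y)) has_field_derivative 0) (at y)"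
      by (auto intro!: derivative_eq_intros)
    thus "((\<lambda>y. D y * exp (- t y)) has_field_derivative 0) (at y within ball 0 (exp (-1)))"
      by (rule has_field_derivative_at_within)
  qed simp
  then obtain C where C: "\<And>y. \<bar>y\<bar> < exp (-1) \<Longrightarrow> D y * exp (- t y) = C" by force
  have "D 0 * exp (- t 0) = 1"
    by (simp add: D_def t_def eval_fps_at_0 tree_fps_def rooted_tree_fps_def)
  hence "D x * exp (- t x) = 1" using C[of x] C[of 0] assms by simp
  hence "D x = exp (t x)" by (simp add: exp_minus field_simps)
  thus ?thesis using eval_rooted_tree_fps_eq[OF assms] by (simp add: D_def t_def)
qed

text \<open>
  If \<open>T\<close> reached the value \<open>1\<close>, it would do so at \<open>y = exp (- 1)\<close> by the functional equation.
\<close>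

lemma eval_rooted_tree_fps_bounds:
  assumes "0 \<le> x" "x < exp (- 1)"
  shows "0 \<le> eval_fps rooted_tree_fps x" "eval_fps rooted_tree_fps x < 1"
proof -
  show "0 \<le> eval_fps rooted_tree_fps x"
    using assms eval_rooted_tree_fps_functional[of x]
    by (metis abs_of_nonneg exp_ge_zero mult_nonneg_nonneg)
  show "eval_fps rooted_tree_fps x < 1"
  proof (rule ccontr)
    assume "\<not> ?thesis"
    moreover have "continuous_on {0..x} (eval_fps rooted_tree_fps)"
    proof (intro continuous_on_subset[OF continuous_on_eval_fps] subsetI)
      fix y assume "y \<in> {0..x}"
      thus "y \<in> eball 0 (fps_conv_radius rooted_tree_fps)"
        using rooted_tree_fps_conv_radius[of y] assms by (auto simp: in_eball_iff)
    qed
    moreover have "eval_fps rooted_tree_fps 0 = 0"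
      by (simp add: eval_fps_at_0 rooted_tree_fps_def)
    ultimately obtain y where y: "0 \<le> y" "y \<le> x" "eval_fps rooted_tree_fps y = 1"
      using IVT'[of "eval_fps rooted_tree_fps" 0 1 x] assms by auto
    have "1 = y * exp 1" using eval_rooted_tree_fps_functional[of y] y assms by simp
    hence "y = exp (- 1)" by (simp add: exp_minus field_simps)
    thus False using y assms by simp
  qed
qed

lemma mult_exp_minus_strict_mono:
  assumes "0 \<le> (s::real)" "s < t" "t \<le> 1"
  shows "s * exp (- s) < t * exp (- t)"
proof -
  have "s / t = 1 - (t - s) / t" using assms by (simp add: field_simps)
  also have "\<dots> \<le> 1 - (t - s)"
    using assms divide_left_mono[of t 1 "t - s"] by simp
  also have "\<dots> < exp (- (t - s))" using assms by (subst exp_minus_greater) simp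
  finally have "s < t * exp (- (t - s))" using assms by (simp add: field_simps)
  hence "s * exp (- s) < t * exp (- (t - s)) * exp (- s)" by simp
  also have "\<dots> = t * exp (- t)" by (simp add: exp_add[symmetric] mult.assoc)
  finally show ?thesis .
qed

text \<open>
  \<open>T(x)\<close> and \<open>c\<close> both lie in \<open>[0, 1]\<close>, where \<open>s exp (- s)\<close> is injective, and both have the image \<open>x\<close>.
\<close>

lemma tree_fps_at_saddle:
  assumes "0 < c" "c < 1"
  shows "c * exp (- c) < exp (- 1)"
    and "eval_fps rooted_tree_fps (c * exp (- c)) = c"
    and "eval_fps tree_fps (c * exp (- c)) = c * (1 - c / 2)"
proof -
  define x where "x = c * exp (- c)"
  define t where "t = eval_fps rooted_tree_fps x"
  show "c * exp (- c) < exp (- 1)" using mult_exp_minus_strict_mono[of c 1] assms by simp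
  hence x: "0 \<le> x" "x < exp (- 1)" "\<bar>x\<bar> < exp (-1)" using assms by (simp_all add: x_def)
  have b: "0 \<le> t" "t < 1" using eval_rooted_tree_fps_bounds[OF x(1,2)] by (auto simp: t_def)
  have "t = x * exp t" using eval_rooted_tree_fps_functional[OF x(3)] by (simp add: t_def)
  hence "t * exp (- t) = c * exp (- c)" by (simp add: x_def exp_minus field_simps)
  hence tc: "t = c"
    using mult_exp_minus_strict_mono[of t c] mult_exp_minus_strict_mono[of c t] assms b
    by (cases t c rule: linorder_cases) auto
  thus "eval_fps rooted_tree_fps (c * exp (- c)) = c" by (simp add: t_def x_def)
  have r: "ereal (norm x) < fps_conv_radius rooted_tree_fps"
    using rooted_tree_fps_conv_radius[OF x(3)] by simp
  have "eval_fps tree_fps x = t - 1/2 * t ^ 2"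
    unfolding tree_fps_eq t_def
    apply (subst eval_fps_diff)
      apply (rule r)
    subgoal
      using less_le_trans[OF less_le_trans[OF r fps_conv_radius_power[of _ 2]]
          fps_conv_radius_mult[of "fps_const (1/2)", simplified]] by simp
    subgoal
      using less_le_trans[OF r fps_conv_radius_power[of _ 2]] r
      by (simp add: eval_fps_mult eval_fps_power)
    done
  thus "eval_fps tree_fps (c * exp (- c)) = c * (1 - c / 2)"
    by (simp add: tc x_def power2_eq_square algebra_simps)
qed

section \<open>Forests counted by powers of the tree series\<close>

text \<open>
  Every other component has a representative outside the component \<open>C\<close> of \<open>v\<close>, so the number \<open>n - t\<close>
  of components is at most \<open>1 + n - |C|\<close>.
\<close>

lemma card_part_le:
  assumes V: "finite V" "v \<in> V" and E: "E \<in> forests V t"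
  shows "card (part E v) \<le> Suc t"
proof -
  have E': "E \<subseteq> edges V" "card E = t" "forest E" using E by (auto simp: forests_def)
  have "parts V E \<subseteq> insert (part E v) (part E ` (V - part E v))"
  proof
    fix C assume "C \<in> parts V E"
    then obtain x where x: "x \<in> V" "C = part E x" unfolding parts_def by blast
    show "C \<in> insert (part E v) (part E ` (V - part E v))"
      using x part_eqI[of x E v] by blast
  qed
  hence "card (parts V E) \<le> card (insert (part E v) (part E ` (V - part E v)))"
    using V by (intro card_mono) simp_all
  also have "\<dots> \<le> Suc (card (part E ` (V - part E v)))" by (rule card_insert_le_m1) simp_all
  also have "\<dots> \<le> Suc (card (V - part E v))" using V card_image_le[of "V - part E v"] by simp
  also have "card (V - part E v) = card V - card (part E v)"
    by (intro card_Diff_subset part_subset finite_subset[OF part_subset V(1)] E' V)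
  finally show ?thesis
    using card_parts[OF V(1) E'(1,3)] E'(2) card_mono[OF V(1) part_subset[OF E'(1) V(2)]] by simp
qed

lemma tree_fps_power_eq_0: "n < m \<Longrightarrow> fps_nth (tree_fps ^ m) n = 0"
  by (rule startsby_zero_power_prefix[rule_format]) (simp_all add: tree_fps_def)

text \<open>
  Coefficients of \<open>x (U\<^bsup>m\<^esup>)' = m (x U') U\<^bsup>m-1\<^esup>\<close>.
\<close>

lemma tree_fps_power_rec:
  "real n * fps_nth (tree_fps ^ m) n =
     real m * (\<Sum>k=1..n. real k * fps_nth tree_fps k * fps_nth (tree_fps ^ (m - 1)) (n - k))"
proof -
  have X: "fps_nth (fps_X * fps_deriv f) k = real k * fps_nth f k" for f :: "real fps" and k
    by (cases k) simp_all
  have "real n * fps_nth (tree_fps ^ m) n = fps_nth (fps_X * fps_deriv (tree_fps ^ m)) n"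
    by (simp only: X)
  also have "fps_X * fps_deriv (tree_fps ^ m) =
      fps_const (real m) * ((fps_X * fps_deriv tree_fps) * tree_fps ^ (m - 1))"
    by (simp add: fps_deriv_power mult_ac)
  also have "fps_nth \<dots> n = real m *
      (\<Sum>k=0..n. real k * fps_nth tree_fps k * fps_nth (tree_fps ^ (m - 1)) (n - k))"
    by (simp only: fps_mult_left_const_nth fps_mult_nth[of "fps_X * fps_deriv tree_fps"] X)
  also have "(\<Sum>k=0..n. real k * fps_nth tree_fps k * fps_nth (tree_fps ^ (m - 1)) (n - k)) =
      (\<Sum>k=1..n. real k * fps_nth tree_fps k * fps_nth (tree_fps ^ (m - 1)) (n - k))"
    by (simp add: sum.atLeast_Suc_atMost)
  finally show ?thesis .
qed

definition forest_count :: "nat \<Rightarrow> nat \<Rightarrow> real" where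
  "forest_count n t = fact n / fact (n - t) * fps_nth (tree_fps ^ (n - t)) n"

text \<open>
  Stated relative to \<open>card_forests\<close> on smaller vertex sets, since it is the induction step of that
  theorem. If \<open>k > t + 1\<close>, both sides vanish: there are too few edges for the component, and
  \<open>U\<^bsup>m-1\<^esup>\<close> has no terms of degree \<open>n - k < m - 1\<close>.
\<close>

lemma card_forests_part_size_aux:
  assumes V: "finite V" "v \<in> V" and t: "t < card V" and k: "1 \<le> k" "k \<le> card V"
    and IH: "\<And>W s. W \<subset> V \<Longrightarrow> s \<le> card W \<Longrightarrow> real (card (forests W s)) = forest_count (card W) s"
  shows "real (card {E \<in> forests V t. card (part E v) = k}) =
           fact (card V - 1) / fact (card V - t - 1) *
             (real k * fps_nth tree_fps k * fps_nth (tree_fps ^ (card V - t - 1)) (card V - k))"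
proof (cases "k - 1 \<le> t")
  case False
  have "{E \<in> forests V t. card (part E v) = k} = {}"
    using card_part_le[OF V, of _ t] False k by fastforce
  hence "card {E \<in> forests V t. card (part E v) = k} = 0" by (simp only: card.empty)
  moreover have "fps_nth (tree_fps ^ (card V - t - 1)) (card V - k) = 0"
    by (rule tree_fps_power_eq_0) (use False t k in linarith)
  ultimately show ?thesis by simp
next
  case True
  define n where "n = card V"
  define q where "q = forest_count (n - k) (t - (k - 1))"
  have W: "real (card (forests W (t - (k - 1)))) = q" if "W \<subseteq> V" "card W = n - k" for W
  proof -
    have "W \<noteq> V" using that(2) k by (auto simp: n_def)
    thus ?thesis using IH[of W "t - (k - 1)"] that t k True by (simp add: q_def n_def psubset_eq)
  qed
  \<comment> \<open>\<open>q\<close> is real; the number of forests on some set of \<open>n - k\<close> vertices is the same value as a natural number.\<close>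
  have "\<exists>W0. W0 \<subseteq> V \<and> card W0 = n - k"
  proof (rule obtain_subset_with_card_n[of "n - k" V])
    show "n - k \<le> card V" by (simp add: n_def)
  qed blast
  then obtain W0 where W0: "W0 \<subseteq> V" "card W0 = n - k" by blast
  have "card (forests W (t - (k - 1))) = card (forests W0 (t - (k - 1)))"
    if "W \<subseteq> V" "card W = card V - k" for W
    using W[OF that(1)] W[OF W0] that(2) by (simp add: n_def)
  hence "card {E \<in> forests V t. card (part E v) = k} =
      ((n - 1) choose (k - 1)) * k ^ (k - 2) * card (forests W0 (t - (k - 1)))"
    using card_forests_with_part_size[OF V k(1) True] by (simp add: n_def)
  hence "real (card {E \<in> forests V t. card (part E v) = k}) =
      real ((n - 1) choose (k - 1)) * real k ^ (k - 2) * q"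
    using W[OF W0] by simp
  also have "n - k - (t - (k - 1)) = n - t - 1" using k t True by (simp add: n_def)
  hence q: "q = fact (n - k) / fact (n - t - 1) * fps_nth (tree_fps ^ (n - t - 1)) (n - k)"
    by (simp add: q_def forest_count_def)
  have "n - 1 - (k - 1) = n - k" using k by simp
  hence bin: "real ((n - 1) choose (k - 1)) = fact (n - 1) / (fact (k - 1) * fact (n - k))"
    using k by (subst binomial_fact) (auto simp: n_def)
  have tk: "real k * fps_nth tree_fps k = real k ^ (k - 2) / fact (k - 1)"
    using k by (simp add: tree_fps_def fact_reduce)
  have "real ((n - 1) choose (k - 1)) * real k ^ (k - 2) * q =
      fact (n - 1) / fact (n - t - 1) *
        (real k ^ (k - 2) / fact (k - 1) * fps_nth (tree_fps ^ (n - t - 1)) (n - k))"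
    unfolding bin q by simp
  finally show ?thesis by (simp only: tk n_def)
qed

text \<open>
  The exponential formula for forests. Summing the preceding lemma over the size of the component
  of a fixed vertex reproduces the recursion \<open>tree_fps_power_rec\<close>.
\<close>

theorem card_forests:
  assumes "finite V" "t \<le> card V"
  shows "real (card (forests V t)) = forest_count (card V) t"
  using assms
proof (induction "card V" arbitrary: V t rule: less_induct)
  case less
  define n where "n = card V"
  show ?case
  proof (cases "t = n")
    case True
    show ?thesis
    proof (cases "V = {}")
      case True
      hence "forests V t = {{}}" using less.prems by (auto simp: forests_def edges_def)
      thus ?thesis using True less.prems by (simp add: forest_count_def)
    next
      case False
      have "forests V t = {}"
      proof (rule equals0I)
        fix E assume "E \<in> forests V t"
        hence "card (parts V E) = 0"
          using card_parts[OF less.prems(1), of E] True by (simp add: forests_def n_def)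
        thus False using less.prems(1) False by (simp add: parts_def)
      qed
      moreover have "n > 0" using False less.prems by (simp add: n_def card_gt_0_iff)
      ultimately show ?thesis using True by (simp add: forest_count_def n_def)
    qed
  next
    case False
    hence t: "t < n" using less.prems by (simp add: n_def)
    hence "V \<noteq> {}" by (auto simp: n_def)
    then obtain v where v: "v \<in> V" by blast
    define m where "m = n - t"
    have m: "m > 0" using t by (simp add: m_def)
    have IH: "real (card (forests W s)) = forest_count (card W) s" if "W \<subset> V" "s \<le> card W" for W s
      using less.hyps[of W s] that less.prems(1) psubset_card_mono finite_subset[of W V] by auto
    have "forests V t = (\<Union>k\<in>{1..n}. {E \<in> forests V t. card (part E v) = k})"
    proof (intro subset_antisym subsetI)
      fix E assume E: "E \<in> forests V t"
      have sub: "part E v \<subseteq> V" by (rule part_subset[OF _ v]) (use E in \<open>simp add: forests_def\<close>)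
      have "card (part E v) \<le> n" unfolding n_def by (rule card_mono[OF less.prems(1) sub])
      moreover have "card (part E v) > 0"
        using finite_subset[OF sub less.prems(1)] self_in_part[of v E] card_gt_0_iff by blast
      ultimately show "E \<in> (\<Union>k\<in>{1..n}. {E \<in> forests V t. card (part E v) = k})"
        using E by simp
    qed blast
    hence "card (forests V t) = card (\<Union>k\<in>{1..n}. {E \<in> forests V t. card (part E v) = k})"
      by (rule arg_cong)
    also have "\<dots> = (\<Sum>k=1..n. card {E \<in> forests V t. card (part E v) = k})"
      using finite_forests[OF less.prems(1), of t] by (intro card_UN_disjoint) auto
    also have "real \<dots> = (\<Sum>k=1..n. fact (n - 1) / fact (m - 1) *
        (real k * fps_nth tree_fps k * fps_nth (tree_fps ^ (m - 1)) (n - k)))"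
      unfolding of_nat_sum
      using card_forests_part_size_aux[OF less.prems(1) v, of t] t IH
      by (intro sum.cong) (auto simp: n_def m_def)
    also have "\<dots> = fact (n - 1) / fact (m - 1) *
        (\<Sum>k=1..n. real k * fps_nth tree_fps k * fps_nth (tree_fps ^ (m - 1)) (n - k))"
      by (simp only: sum_distrib_left)
    also have "\<dots> = fact (n - 1) / fact (m - 1) * (real n * fps_nth (tree_fps ^ m) n / real m)"
      unfolding tree_fps_power_rec using m by simp
    also have "\<dots> = fact n / fact m * fps_nth (tree_fps ^ m) n"
      using m t by (simp add: fact_reduce[of n] fact_reduce[of m] mult_ac)
    finally show ?thesis by (simp add: forest_count_def n_def m_def)
  qed
qed

theorem card_forests_part_size_ratio:
  assumes V: "finite V" "v \<in> V" and t: "t < card V" and k: "1 \<le> k" "k \<le> card V"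
  defines "n \<equiv> card V"
  defines "m \<equiv> card V - t"
  shows "real (card {E \<in> forests V t. card (part E v) = k}) / real (card (forests V t)) =
    real k * (real m / real n) *
      (fps_nth tree_fps k * fps_nth (tree_fps ^ (m - 1)) (n - k) / fps_nth (tree_fps ^ m) n)"
proof -
  have m: "m > 0" "n > 0" using t unfolding m_def n_def by linarith+
  have "real (card {E \<in> forests V t. card (part E v) = k}) = fact (n - 1) / fact (m - 1) *
             (real k * fps_nth tree_fps k * fps_nth (tree_fps ^ (m - 1)) (n - k))"
    unfolding n_def m_def
  proof (rule card_forests_part_size_aux[OF V t k])
    fix W s assume "W \<subset> V" "s \<le> card W"
    thus "real (card (forests W s)) = forest_count (card W) s"
      using card_forests[of W s] finite_subset[OF _ V(1), of W] by (simp add: psubset_eq)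
  qed
  hence num: "real (card {E \<in> forests V t. card (part E v) = k}) = fact (n - 1) / fact (m - 1) *
      (real k * (fps_nth tree_fps k * fps_nth (tree_fps ^ (m - 1)) (n - k)))"
    by (simp only: mult.assoc)
  have "real (card (forests V t)) = fact n / fact m * fps_nth (tree_fps ^ m) n"
    using card_forests[OF V(1), of t] t by (simp add: forest_count_def n_def m_def)
  moreover have "fact n = real n * fact (n - 1)" "fact m = real m * fact (m - 1)"
    using m by (simp_all add: fact_reduce)
  ultimately have den: "real (card (forests V t)) =
      real n * fact (n - 1) / (real m * fact (m - 1)) * fps_nth (tree_fps ^ m) n" by simp
  show ?thesis unfolding num den using m by simp
qed

section \<open>Coefficients of large powers of a nonnegative power series\<close>

definition nonneg_fps :: "real fps \<Rightarrow> bool" where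
  "nonneg_fps f \<longleftrightarrow> (\<forall>n. fps_nth f n \<ge> 0)"

lemma nonneg_fps_mult: "nonneg_fps f \<Longrightarrow> nonneg_fps g \<Longrightarrow> nonneg_fps (f * g)"
  by (simp add: nonneg_fps_def fps_mult_nth sum_nonneg)

lemma nonneg_fps_power: "nonneg_fps f \<Longrightarrow> nonneg_fps (f ^ m)"
proof (induction m)
  case 0
  show ?case by (auto simp: nonneg_fps_def fps_one_nth)
qed (simp add: nonneg_fps_mult)

lemma nonneg_fps_coeff_le_eval:
  assumes "nonneg_fps f" "x \<ge> 0" "ereal x < fps_conv_radius f"
  shows "fps_nth f n * x ^ n \<le> eval_fps f x"
proof -
  have "(\<Sum>k\<in>{n}. fps_nth f k * x ^ k) \<le> (\<Sum>k. fps_nth f k * x ^ k)"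
    using assms summable_fps[of x f] by (intro sum_le_suminf) (auto simp: nonneg_fps_def)
  thus ?thesis by (simp add: eval_fps_def)
qed

text \<open>
  Chernoff's bound for both tails: \<open>y\<^bsup>n-b\<^esup> \<ge> 1\<close> for \<open>n > b\<close> and \<open>z\<^bsup>n-a\<^esup> \<ge> 1\<close> for \<open>n < a\<close>.
\<close>

lemma nonneg_fps_window:
  assumes f: "nonneg_fps f" and x: "x > 0" and y: "y \<ge> 1" "ereal (x * y) < fps_conv_radius f"
    and z: "0 < z" "z \<le> 1"
  shows "eval_fps f x - eval_fps f (x * y) / y ^ b - eval_fps f (x * z) / z ^ a
           \<le> (\<Sum>n=a..b. fps_nth f n * x ^ n)"
proof -
  have xy: "x \<le> x * y" "x * z \<le> x" using x y z mult_left_mono[of 1 y x] mult_left_mono[of z 1 x] by simp_all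
  have r: "ereal x < fps_conv_radius f" "ereal (x * z) < fps_conv_radius f"
    using xy y(2) by (metis ereal_less_eq(3) order_le_less_trans)+
  have s: "(\<lambda>n. fps_nth f n * x ^ n) sums eval_fps f x"
    "(\<lambda>n. fps_nth f n * (x * y) ^ n) sums eval_fps f (x * y)"
    "(\<lambda>n. fps_nth f n * (x * z) ^ n) sums eval_fps f (x * z)"
    using r x y z by (intro sums_eval_fps; simp)+
  let ?i = "\<lambda>n. if n \<in> {a..b} then fps_nth f n * x ^ n else 0"
  have major: "(\<lambda>n. ?i n + fps_nth f n * (x * y) ^ n / y ^ b + fps_nth f n * (x * z) ^ n / z ^ a) sums
      (sum (\<lambda>n. fps_nth f n * x ^ n) {a..b} + eval_fps f (x * y) / y ^ b + eval_fps f (x * z) / z ^ a)"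
    by (intro sums_add sums_divide sums_If_finite_set s) simp
  have le: "fps_nth f n * x ^ n \<le>
      ?i n + fps_nth f n * (x * y) ^ n / y ^ b + fps_nth f n * (x * z) ^ n / z ^ a" for n
  proof -
    have c: "fps_nth f n * x ^ n \<ge> 0" using f x by (simp add: nonneg_fps_def)
    have p: "fps_nth f n * (x * y) ^ n / y ^ b \<ge> 0" "fps_nth f n * (x * z) ^ n / z ^ a \<ge> 0"
      using f x y z by (auto simp: nonneg_fps_def)
    consider "n \<in> {a..b}" | "n > b" | "n < a" by fastforce
    thus ?thesis
    proof cases
      case 2
      have "fps_nth f n * x ^ n * 1 \<le> fps_nth f n * x ^ n * (y ^ n / y ^ b)"
        using 2 y power_increasing[of b n y] zero_less_power[of y b]
        by (intro mult_left_mono[OF _ c]) (simp add: le_divide_eq)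
      thus ?thesis using p 2 by (simp add: power_mult_distrib mult_ac)
    next
      case 3
      have "fps_nth f n * x ^ n * 1 \<le> fps_nth f n * x ^ n * (z ^ n / z ^ a)"
        using 3 z power_decreasing[of n a z] zero_less_power[of z a]
        by (intro mult_left_mono[OF _ c]) (simp add: le_divide_eq)
      thus ?thesis using p 3 by (simp add: power_mult_distrib mult_ac)
    qed (use p in auto)
  qed
  have "eval_fps f x \<le> sum (\<lambda>n. fps_nth f n * x ^ n) {a..b}
      + eval_fps f (x * y) / y ^ b + eval_fps f (x * z) / z ^ a"
    by (rule sums_le[OF le s(1) major])
  thus ?thesis by simp
qed

text \<open>
  Every \<open>l\<close> between \<open>j\<close> and \<open>2 j\<close> is a sum of \<open>j\<close> terms from \<open>{1, 2}\<close>.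
\<close>

lemma two_step_power_lower:
  assumes f: "nonneg_fps f" and K: "K \<ge> 0" "K \<le> fps_nth f 1 * x" "K \<le> fps_nth f 2 * x ^ 2" and x: "x \<ge> 0"
    and "j \<le> l" "l \<le> 2 * j"
  shows "K ^ j \<le> fps_nth (f ^ j) l * x ^ l"
  using assms(6,7)
proof (induction j arbitrary: l)
  case (Suc j)
  have pos: "fps_nth f i \<ge> 0" "fps_nth (f ^ j) i \<ge> 0" for i
    using f nonneg_fps_power[OF f] by (auto simp: nonneg_fps_def)
  obtain i where i: "i \<in> {1, 2}" "i \<le> l" "j \<le> l - i" "l - i \<le> 2 * j"
  proof (cases "l \<le> Suc (2 * j)")
    case True
    thus ?thesis using Suc.prems by (intro that[of 1]) auto
  next
    case False
    thus ?thesis using Suc.prems by (intro that[of 2]) auto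
  qed
  have "K ^ Suc j \<le> (fps_nth f i * x ^ i) * (fps_nth (f ^ j) (l - i) * x ^ (l - i))"
    using i K Suc.IH[of "l - i"] pos x by (auto intro!: mult_mono)
  also have "\<dots> = (fps_nth f i * fps_nth (f ^ j) (l - i)) * (x ^ i * x ^ (l - i))"
    by (simp only: mult_ac)
  also have "x ^ i * x ^ (l - i) = x ^ l" using i by (simp flip: power_add)
  also have "(fps_nth f i * fps_nth (f ^ j) (l - i)) * x ^ l \<le> fps_nth (f ^ Suc j) l * x ^ l"
  proof (rule mult_right_mono)
    show "fps_nth f i * fps_nth (f ^ j) (l - i) \<le> fps_nth (f ^ Suc j) l"
      unfolding power_Suc fps_mult_nth
      by (rule member_le_sum[of i "{0..l}" "\<lambda>i. fps_nth f i * fps_nth (f ^ j) (l - i)"])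
        (use i pos in \<open>auto intro: mult_nonneg_nonneg\<close>)
  qed (use x in simp)
  finally show ?case .
qed auto

text \<open>
  Expand \<open>(s A + B)\<^bsup>m\<^esup>\<close> in powers of \<open>s\<close> and regard the coefficients of \<open>x\<^bsup>n\<^esup>\<close> at \<open>s = 1\<close> as weights of
  the exponents \<open>j\<close>. Then \<open>M\<close> is the mean of \<open>j\<close>, and the inequality is Jensen's for the convex
  function \<open>s\<^bsup>j\<^esup>\<close> of \<open>j\<close>.
\<close>

lemma exp_tilt_power_lower:
  assumes A: "nonneg_fps A" and B: "nonneg_fps B" and s: "s > 0"
    and u: "fps_nth ((A + B) ^ m) n > 0"
  defines "M \<equiv> real m * fps_nth (A * (A + B) ^ (m - 1)) n / fps_nth ((A + B) ^ m) n"
  shows "fps_nth ((A + B) ^ m) n * exp (M * ln s) \<le> fps_nth ((fps_const s * A + B) ^ m) n"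
proof -
  define D where "D = (\<lambda>j. real (m choose j) * fps_nth (A ^ j * B ^ (m - j)) n)"
  have D0: "D j \<ge> 0" for j
    using nonneg_fps_mult[OF nonneg_fps_power[OF A] nonneg_fps_power[OF B]]
    by (simp add: D_def nonneg_fps_def)
  have gen: "fps_nth ((fps_const r * A + B) ^ m) n = (\<Sum>j\<le>m. r ^ j * D j)" for r
  proof -
    have "(fps_const r * A + B) ^ m = (\<Sum>j\<le>m. fps_const (real (m choose j) * r ^ j) * (A ^ j * B ^ (m - j)))"
      unfolding binomial_ring
      by (intro sum.cong) (simp_all add: power_mult_distrib fps_const_power mult_ac
           flip: fps_of_nat fps_const_mult)
    thus ?thesis
      by (simp only: fps_sum_nth fps_mult_left_const_nth D_def) (simp add: mult_ac)
  qed
  have sumD: "(\<Sum>j\<le>m. D j) = fps_nth ((A + B) ^ m) n" using gen[of 1] by simp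
  have "(\<Sum>j\<le>m. real j * D j) = real m * fps_nth (A * (A + B) ^ (m - 1)) n"
  proof (cases m)
    case (Suc l)
    have "(\<Sum>j\<le>m. real j * D j) = (\<Sum>j\<le>l. real (Suc j) * D (Suc j))"
      unfolding Suc by (subst sum.atMost_Suc_shift) simp
    also have "\<dots> = (\<Sum>j\<le>l. real m * (real (l choose j) * fps_nth (A * (A ^ j * B ^ (l - j))) n))"
    proof (rule sum.cong)
      fix j
      have "real (Suc j) * real (Suc l choose Suc j) = real (Suc l) * real (l choose j)"
        using arg_cong[OF Suc_times_binomial_eq[of l j], of real]
        by (simp only: of_nat_mult mult.commute)
      thus "real (Suc j) * D (Suc j) =
          real m * (real (l choose j) * fps_nth (A * (A ^ j * B ^ (l - j))) n)"
        by (simp add: D_def Suc mult.assoc del: of_nat_Suc binomial_Suc_Suc)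
    qed simp
    also have "\<dots> = real m * fps_nth (A * (A + B) ^ l) n"
    proof -
      have "A * (A + B) ^ l =
          (\<Sum>j\<le>l. fps_const (real (l choose j)) * (A * (A ^ j * B ^ (l - j))))"
        by (simp add: binomial_ring sum_distrib_left mult_ac flip: fps_of_nat)
      thus ?thesis
        by (simp only: fps_sum_nth fps_mult_left_const_nth sum_distrib_left)
    qed
    finally show ?thesis by (simp add: Suc)
  qed simp
  hence mean: "(\<Sum>j\<le>m. real j * D j) = M * (\<Sum>j\<le>m. D j)" using u by (simp add: M_def sumD)
  have "(\<Sum>j\<le>m. exp (M * ln s) * (1 + (real j - M) * ln s) * D j) =
      (\<Sum>j\<le>m. exp (M * ln s) * D j + exp (M * ln s) * ln s * (real j * D j)
        - exp (M * ln s) * ln s * M * D j)"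
    by (intro sum.cong) (simp_all add: algebra_simps)
  also have "\<dots> = exp (M * ln s) * (\<Sum>j\<le>m. D j)
      + exp (M * ln s) * ln s * (\<Sum>j\<le>m. real j * D j)
      - exp (M * ln s) * ln s * M * (\<Sum>j\<le>m. D j)"
    by (simp only: sum.distrib sum_subtractf sum_distrib_left)
  also have "\<dots> = (\<Sum>j\<le>m. D j) * exp (M * ln s)" by (simp add: mean)
  finally have "(\<Sum>j\<le>m. D j) * exp (M * ln s) =
      (\<Sum>j\<le>m. exp (M * ln s) * (1 + (real j - M) * ln s) * D j)" by (rule sym)
  also have "\<dots> \<le> (\<Sum>j\<le>m. s ^ j * D j)"
  proof (intro sum_mono mult_right_mono D0)
    fix j
    have "exp (M * ln s) * (1 + (real j - M) * ln s) \<le> exp (M * ln s) * exp ((real j - M) * ln s)"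
      by (intro mult_left_mono exp_ge_add_one_self) auto
    also have "\<dots> = s ^ j"
      using s by (simp add: algebra_simps flip: exp_add) (simp add: exp_of_nat_mult)
    finally show "exp (M * ln s) * (1 + (real j - M) * ln s) \<le> s ^ j" .
  qed
  finally show ?thesis by (simp add: gen sumD)
qed

text \<open>
  Probabilistically, \<open>m\<close> independent variables with weights \<open>f\<^sub>j x\<^bsup>j\<^esup> / f(x)\<close> and mean \<open>\<mu>\<close> add up to
  \<open>n \<approx> \<mu> m\<close> with a probability that is not exponentially small. A small proportion \<open>\<eta>\<close> of the variables
  is reserved for corrections: the sum of the others lies in the window \<open>{n - 2j..n - j}\<close> with
  probability at least \<open>1/2\<close>, since \<open>1 < \<mu> < 2\<close> puts its mean \<open>n - \<mu> j\<close> well inside the window, and the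
  \<open>j\<close> reserved variables fill the gap with the values \<open>1\<close> and \<open>2\<close> at a cost of \<open>\<kappa>\<^bsup>j\<^esup>\<close>, which is at
  least \<open>exp (- \<epsilon> m / 2)\<close> for small \<open>\<eta>\<close>.
\<close>

lemma fps_power_coeff_subexponential:
  fixes m n :: "nat \<Rightarrow> nat"
  assumes f: "nonneg_fps f" and f12: "fps_nth f 1 > 0" "fps_nth f 2 > 0"
    and x: "x > 0" "ereal x < fps_conv_radius f"
    and mu: "\<mu> = x * eval_fps (fps_deriv f) x / eval_fps f x" "1 < \<mu>" "\<mu> < 2"
    and m: "filterlim m at_top sequentially"
    and n: "(\<lambda>i. real (n i) / real (m i)) \<longlonglongrightarrow> \<mu>"
    and eps: "\<epsilon> > 0"
  shows "eventually (\<lambda>i. eval_fps f x ^ m i * exp (- \<epsilon> * real (m i))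
           \<le> fps_nth (f ^ m i) (n i) * x ^ n i) sequentially"
proof -
  define F where "F = eval_fps f"
  have coeff_le: "fps_nth f k * x ^ k \<le> F x" for k
    unfolding F_def by (rule nonneg_fps_coeff_le_eval) (use f x in auto)
  have Fx: "F x > 0" using coeff_le[of 1] f12 x by (auto intro: less_le_trans[rotated])
  define K where "K = min (fps_nth f 1 * x) (fps_nth f 2 * x ^ 2)"
  have K: "K > 0" "K \<le> fps_nth f 1 * x" "K \<le> fps_nth f 2 * x ^ 2"
    using f12 x by (auto simp: K_def)
  define \<kappa> where "\<kappa> = K / F x"
  have kappa: "0 < \<kappa>" "\<kappa> \<le> 1" using K Fx coeff_le[of 1] by (auto simp: \<kappa>_def divide_le_eq_1)
  define L where "L = - ln \<kappa>"
  have L: "L \<ge> 0" using kappa by (simp add: L_def)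
  define \<eta> where "\<eta> = min (1/2) (\<epsilon> / (2 * (L + 1)))"
  have eta: "0 < \<eta>" "\<eta> \<le> 1/2" "\<eta> * L \<le> \<epsilon> / 2"
  proof -
    show "0 < \<eta>" using eps L by (simp add: \<eta>_def)
    show "\<eta> \<le> 1/2" unfolding \<eta>_def by (rule min.cobounded1)
    have "\<eta> * L \<le> \<epsilon> / (2 * (L + 1)) * L" using L by (intro mult_right_mono) (auto simp: \<eta>_def)
    also have "\<dots> \<le> \<epsilon> / 2" using L eps by (simp add: field_simps)
    finally show "\<eta> * L \<le> \<epsilon> / 2" .
  qed
  have xr: "ereal (norm x) < fps_conv_radius f" using x by simp
  have dF: "((\<lambda>y. F (x * y)) has_real_derivative \<mu> * F x) (at 1)"
  proof -
    have "(F has_field_derivative eval_fps (fps_deriv f) x) (at (x * 1))"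
      unfolding F_def using has_field_derivative_eval_fps[OF xr] by simp
    from DERIV_chain2[where g = "\<lambda>y. x * y" and x = 1, OF this, of x] 
    have "((\<lambda>y. F (x * y)) has_real_derivative eval_fps (fps_deriv f) x * x) (at 1)"
      by (auto intro!: derivative_eq_intros)
    thus ?thesis using Fx by (simp add: mu F_def mult.commute)
  qed
  define \<phi> where "\<phi> = (\<lambda>b y. (1 - \<eta>) * (ln (F (x * y)) - ln (F x)) - (\<mu> - b) * ln y)"
  have d\<phi>: "(\<phi> b has_real_derivative ((1 - \<eta>) * \<mu> - (\<mu> - b))) (at 1)" for b
    unfolding \<phi>_def using Fx
    by (auto intro!: derivative_eq_intros DERIV_chain2[OF DERIV_ln] dF)
  have \<phi>1: "\<phi> b 1 = 0" for b by (simp add: \<phi>_def)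
  \<comment> \<open>The exponential rates of both tails vanish at the value 1 of the tilting parameter. Their
    derivatives there have the right signs because \<open>1 < \<mu>\<close> and \<open>\<mu> < 2\<close>.\<close>
  have "(1 - \<eta>) * \<mu> - (\<mu> - \<eta>) < 0" using eta mu(2,3) by (simp add: algebra_simps)
  from DERIV_neg_dec_right[OF d\<phi> this] obtain d where d: "d > 0" "\<And>h. 0 < h \<Longrightarrow> h < d \<Longrightarrow> \<phi> \<eta> (1 + h) < 0"
    by (auto simp: \<phi>1)
  have "(1 - \<eta>) * \<mu> - (\<mu> - 2 * \<eta>) > 0" using eta mu(2,3) by (simp add: algebra_simps)
  from DERIV_pos_inc_left[OF d\<phi> this] obtain e where e: "e > 0" "\<And>h. 0 < h \<Longrightarrow> h < e \<Longrightarrow> \<phi> (2*\<eta>) (1 - h) < 0"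
    by (auto simp: \<phi>1)
  \<comment> \<open>The tilted argument \<open>x * y\<close> has to stay inside the disc of convergence.\<close>
  obtain R where R: "x < R" "ereal R < fps_conv_radius f"
    using ereal_dense2[OF x(2)] by auto
  define y where "y = 1 + min (d / 2) ((R - x) / x)"
  have y: "y > 1" "ereal (x * y) < fps_conv_radius f" "\<phi> \<eta> y < 0"
  proof -
    show "y > 1" using d R x by (auto simp: y_def)
    have "x * y \<le> x * (1 + (R - x) / x)" using x by (intro mult_left_mono) (auto simp: y_def)
    also have "\<dots> = R" using x by (simp add: field_simps)
    finally show "ereal (x * y) < fps_conv_radius f" using R(2)
      by (metis ereal_less_eq(3) order_le_less_trans)
    show "\<phi> \<eta> y < 0" unfolding y_def by (rule d(2)) (use d R x in auto)
  qed
  define z where "z = 1 - min (e / 2) (1 / 2)"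
  have z: "0 < z" "z < 1" "\<phi> (2 * \<eta>) z < 0"
    unfolding z_def using e by auto
  have Fpos: "F w > 0" if "w > 0" "ereal w < fps_conv_radius f" for w
  proof -
    have "0 < fps_nth f 1 * w ^ 1" using f12 that by simp
    also have "\<dots> \<le> F w" unfolding F_def
      by (rule nonneg_fps_coeff_le_eval) (use f that in auto)
    finally show ?thesis .
  qed
  have xz: "ereal (x * z) < fps_conv_radius f"
  proof -
    have "x * z \<le> x" using x z by simp
    thus ?thesis using x(2) by (metis ereal_less_eq(3) order_le_less_trans)
  qed
  have Fxy: "F (x * y) > 0" "F (x * z) > 0" using x y z xz by (auto intro!: Fpos)

  define j where "j = (\<lambda>i. nat \<lfloor>\<eta> * real (m i)\<rfloor>)"
  have j: "real (j i) \<le> \<eta> * real (m i)" "\<eta> * real (m i) - 1 \<le> real (j i)" for i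
    using eta by (auto simp: j_def)
  have jm: "j i \<le> m i" for i
  proof -
    have "real (j i) \<le> 1 * real (m i)" using j(1)[of i] eta by (intro order.trans[OF j(1)] mult_right_mono) auto
    thus ?thesis by simp
  qed
  have mreal: "filterlim (\<lambda>i. real (m i)) at_top sequentially"
    using filterlim_compose[OF filterlim_real_sequentially m] .
  have mpos: "eventually (\<lambda>i. real (m i) > 0) sequentially"
    using mreal unfolding filterlim_at_top_dense by blast
  have minv: "(\<lambda>i. 1 / real (m i)) \<longlonglongrightarrow> 0"
    by (rule tendsto_divide_0[OF tendsto_const]) (rule filterlim_at_top_imp_at_infinity[OF mreal])
  have jlim: "(\<lambda>i. real (j i) / real (m i)) \<longlonglongrightarrow> \<eta>"
  proof (rule tendsto_sandwich)
    show "eventually (\<lambda>i. \<eta> - 1 / real (m i) \<le> real (j i) / real (m i)) sequentially"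
      using mpos
    proof eventually_elim
      case (elim i)
      thus ?case using divide_right_mono[OF j(2)[of i], of "real (m i)"]
        by (simp add: diff_divide_distrib)
    qed
    show "eventually (\<lambda>i. real (j i) / real (m i) \<le> \<eta>) sequentially"
      using mpos by eventually_elim (use j in \<open>auto simp: field_simps\<close>)
    show "(\<lambda>i. \<eta> - 1 / real (m i)) \<longlonglongrightarrow> \<eta>"
      using tendsto_diff[OF tendsto_const[of \<eta>] minv] by simp
  qed auto
  have nj: "eventually (\<lambda>i. 2 * j i \<le> n i) sequentially"
  proof -
    have "eventually (\<lambda>i. real (n i) / real (m i) > 1) sequentially"
      using n mu(2) by (rule order_tendstoD)
    thus ?thesis using mpos
    proof eventually_elim
      case (elim i)
      have "2 * real (j i) \<le> 2 * (\<eta> * real (m i))" using j(1)[of i] by simp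
      also have "\<dots> \<le> 1 * real (m i)" using eta by (simp only: mult.assoc[symmetric], intro mult_right_mono) auto
      also have "\<dots> \<le> real (n i)" using elim by (simp add: field_simps)
      finally show ?case by simp
    qed
  qed

  have tail: "eventually (\<lambda>i. F (x * w) ^ (m i - j i) / w ^ (n i - q * j i) \<le> F x ^ (m i - j i) / 4) sequentially"
    if w: "w > 0" "F (x * w) > 0" "\<phi> (real q * \<eta>) w < 0" and q: "q \<in> {1, 2}" for w q
  proof -
    \<comment> \<open>\<open>g\<close> is the logarithm of the tail bound relative to \<open>F x ^ (m i - j i)\<close>, divided by \<open>m i\<close>.\<close>
    define g where "g = (\<lambda>i. (1 - real (j i) / real (m i)) * (ln (F (x * w)) - ln (F x))
        - (real (n i) / real (m i) - real q * (real (j i) / real (m i))) * ln w)"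
    have "g \<longlonglongrightarrow> \<phi> (real q * \<eta>) w"
      unfolding g_def \<phi>_def by (intro tendsto_intros jlim n)
    hence "LIM i sequentially. g i * real (m i) :> at_bot"
      using w(3) mreal by (rule filterlim_tendsto_neg_mult_at_bot)
    hence "eventually (\<lambda>i. g i * real (m i) \<le> ln (1/4)) sequentially"
      by (simp add: filterlim_at_bot)
    thus ?thesis using mpos nj
    proof eventually_elim
      case (elim i)
      have nq: "q * j i \<le> n i" using elim q by auto
      have "g i * real (m i) = real (m i - j i) * (ln (F (x * w)) - ln (F x)) - real (n i - q * j i) * ln w"
        using elim jm[of i] nq by (simp add: g_def of_nat_diff field_simps)
      hence "exp (real (m i - j i) * ln (F (x * w)) - real (m i - j i) * ln (F x) - real (n i - q * j i) * ln w) \<le> exp (ln (1/4))"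
        using elim(1) unfolding exp_le_cancel_iff by (simp only: right_diff_distrib) 
      also have "exp (real (m i - j i) * ln (F (x * w)) - real (m i - j i) * ln (F x) - real (n i - q * j i) * ln w)
          = F (x * w) ^ (m i - j i) / w ^ (n i - q * j i) / F x ^ (m i - j i)"
        using w Fx by (simp add: exp_diff exp_of_nat_mult)
      finally have "F (x * w) ^ (m i - j i) / w ^ (n i - q * j i) / F x ^ (m i - j i) \<le> 1 / 4"
        by simp
      thus ?case using Fx by (subst (asm) pos_divide_le_eq) simp_all
    qed
  qed
  have "LIM i sequentially. \<epsilon> / 2 * real (m i) :> at_top"
    by (rule filterlim_tendsto_pos_mult_at_top[OF tendsto_const _ mreal]) (use eps in simp)
  hence "eventually (\<lambda>i. ln 2 \<le> \<epsilon> / 2 * real (m i)) sequentially"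
    unfolding filterlim_at_top by blast
  moreover have "eventually (\<lambda>i. F (x * y) ^ (m i - j i) / y ^ (n i - 1 * j i) \<le> F x ^ (m i - j i) / 4) sequentially"
    by (rule tail) (use y Fxy in auto)
  moreover have "eventually (\<lambda>i. F (x * z) ^ (m i - j i) / z ^ (n i - 2 * j i) \<le> F x ^ (m i - j i) / 4) sequentially"
    by (rule tail) (use z Fxy in auto)
  ultimately show ?thesis using nj
  proof eventually_elim
    case (elim i)
    define M N J where "M = m i - j i" and "N = n i" and "J = j i"
    have MJ: "m i = M + J" using jm by (simp add: M_def J_def)
    have NJ: "2 * J \<le> N" using elim by (simp add: N_def J_def)
    have rad: "fps_conv_radius f \<le> fps_conv_radius (f ^ M)" by (rule fps_conv_radius_power)
    have ev: "eval_fps (f ^ M) w = F w ^ M" if "w > 0" "ereal w < fps_conv_radius f" for w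
      using that by (simp add: eval_fps_power F_def)
    have c: "fps_nth (f ^ p) l \<ge> 0" for p l
      using nonneg_fps_power[OF f] by (simp add: nonneg_fps_def)
    have "F x ^ M - F (x * y) ^ M / y ^ (N - J) - F (x * z) ^ M / z ^ (N - 2 * J)
        \<le> (\<Sum>l=N-2*J..N-J. fps_nth (f ^ M) l * x ^ l)"
      using nonneg_fps_window[OF nonneg_fps_power[OF f], of x y M z "N - J" "N - 2 * J"]
        x y z xz less_le_trans[OF _ rad] by (simp add: ev)
    hence win: "F x ^ M / 2 \<le> (\<Sum>l=N-2*J..N-J. fps_nth (f ^ M) l * x ^ l)"
      using elim by (simp add: M_def N_def J_def)
    have "F x ^ M / 2 * K ^ J \<le> (\<Sum>l=N-2*J..N-J. fps_nth (f ^ M) l * x ^ l) * K ^ J"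
      using win K by (intro mult_right_mono) auto
    also have "\<dots> \<le> (\<Sum>l=N-2*J..N-J. fps_nth (f ^ M) l * x ^ l * (fps_nth (f ^ J) (N - l) * x ^ (N - l)))"
      unfolding sum_distrib_right
    proof (intro sum_mono mult_left_mono)
      fix l assume l: "l \<in> {N-2*J..N-J}"
      show "K ^ J \<le> fps_nth (f ^ J) (N - l) * x ^ (N - l)"
        by (rule two_step_power_lower[OF f]) (use K x l NJ in auto)
    qed (use c x in auto)
    also have "\<dots> = (\<Sum>l=N-2*J..N-J. fps_nth (f ^ M) l * fps_nth (f ^ J) (N - l)) * x ^ N"
      unfolding sum_distrib_right
      by (intro sum.cong) (auto simp: mult_ac simp flip: power_add)
    also have "\<dots> \<le> fps_nth (f ^ m i) (n i) * x ^ n i"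
      unfolding MJ power_add fps_mult_nth N_def[symmetric] using c x
      by (intro mult_right_mono sum_mono2) auto
    finally have low: "F x ^ M / 2 * K ^ J \<le> fps_nth (f ^ m i) (n i) * x ^ n i" .
    have "exp (- \<epsilon> * real (m i)) \<le> exp (- (real J * L) - ln 2)"
    proof -
      have "real J * L \<le> \<eta> * real (m i) * L" using j(1)[of i] L by (intro mult_right_mono) (auto simp: J_def)
      also have "\<dots> = \<eta> * L * real (m i)" by (simp add: mult_ac)
      also have "\<dots> \<le> \<epsilon> / 2 * real (m i)" using eta by (intro mult_right_mono) auto
      finally show ?thesis using elim(1) by (simp add: algebra_simps)
    qed
    also have "\<dots> = \<kappa> ^ J / 2"
      using kappa by (simp add: exp_diff L_def exp_of_nat_mult)
    finally have "F x ^ m i * exp (- \<epsilon> * real (m i)) \<le> F x ^ m i * (\<kappa> ^ J / 2)"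
      using Fx by (intro mult_left_mono) auto
    also have "\<dots> = F x ^ M / 2 * K ^ J"
      using Fx by (simp add: MJ power_add \<kappa>_def power_divide)
    finally show ?case using low by (simp add: F_def)
  qed
qed

text \<open>
  The sequence in question is the mean proportion of the value \<open>k\<close> among \<open>m\<close> variables conditioned to
  add up to \<open>n\<close>. By Jensen's inequality (\<open>exp_tilt_power_lower\<close>) its exponential moment
  is bounded from below, and by the value of the tilted series at \<open>x\<close> from above; the
  conditioning costs only a subexponential factor. With \<open>s = exp h\<close> and error \<open>\<epsilon> = h\<^sup>2\<close>, the limits
  \<open>h \<rightarrow> 0\<close> from the right and from the left give the upper and the lower bound.
\<close>

lemma fps_power_part_frequency:
  fixes m n :: "nat \<Rightarrow> nat"
  assumes f: "nonneg_fps f" and f12: "fps_nth f 1 > 0" "fps_nth f 2 > 0"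
    and x: "x > 0" "ereal x < fps_conv_radius f"
    and mu: "\<mu> = x * eval_fps (fps_deriv f) x / eval_fps f x" "1 < \<mu>" "\<mu> < 2"
    and m: "filterlim m at_top sequentially"
    and n: "(\<lambda>i. real (n i) / real (m i)) \<longlonglongrightarrow> \<mu>"
  shows "(\<lambda>i. fps_nth f k * fps_nth (f ^ (m i - 1)) (n i - k) / fps_nth (f ^ m i) (n i))
           \<longlonglongrightarrow> fps_nth f k * x ^ k / eval_fps f x"
proof -
  define a where "a = fps_nth f k"
  define A where "A = fps_const a * fps_X ^ k"
  define B where "B = f - A"
  define F where "F = eval_fps f x"
  define p where "p = a * x ^ k / F"
  define r where "r = (\<lambda>i. a * fps_nth (f ^ (m i - 1)) (n i - k) / fps_nth (f ^ m i) (n i))"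
  have a: "a \<ge> 0" using f by (simp add: a_def nonneg_fps_def)
  have A: "nonneg_fps A" using a by (simp add: A_def nonneg_fps_def fps_X_power_nth)
  have B: "nonneg_fps B"
    using f by (auto simp: B_def A_def nonneg_fps_def fps_X_power_nth a_def)
  have AB: "A + B = f" by (simp add: B_def)
  have "0 < fps_nth f 1 * x ^ 1" using f12 x by simp
  also have "\<dots> \<le> F" unfolding F_def by (rule nonneg_fps_coeff_le_eval) (use f x in auto)
  finally have F: "F > 0" .
  have p: "p \<ge> 0" "p \<le> 1"
    using a x F nonneg_fps_coeff_le_eval[OF f _ x(2), of k] by (auto simp: p_def a_def F_def)
  have mreal: "filterlim (\<lambda>i. real (m i)) at_top sequentially"
    using filterlim_compose[OF filterlim_real_sequentially m] .
  have mpos: "eventually (\<lambda>i. real (m i) > 0) sequentially"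
    using mreal unfolding filterlim_at_top_dense by blast
  have nk: "eventually (\<lambda>i. n i \<ge> k) sequentially"
  proof -
    have "eventually (\<lambda>i. real (n i) / real (m i) > 1) sequentially"
      using n mu(2) by (rule order_tendstoD)
    moreover have "eventually (\<lambda>i. real k \<le> real (m i)) sequentially"
      using mreal unfolding filterlim_at_top by blast
    ultimately show ?thesis using mpos by eventually_elim (auto simp: field_simps)
  qed
  have key: "eventually (\<lambda>i. r i * ln s \<le> (s - 1) * p + \<epsilon>) sequentially"
    if s: "s > 0" and eps: "\<epsilon> > 0" for s \<epsilon>
    using fps_power_coeff_subexponential[OF f f12 x mu m n eps] mpos nk
  proof eventually_elim
    case (elim i)
    define u where "u = fps_nth (f ^ m i) (n i)"
    define G where "G = fps_const s * A + B"
    have G: "nonneg_fps G" using A B s by (auto simp: G_def nonneg_fps_def)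
    have "0 < F ^ m i * exp (- \<epsilon> * real (m i))" using F by simp
    also have "\<dots> \<le> u * x ^ n i" using elim by (simp add: u_def F_def)
    finally have u: "u > 0" using x by (simp add: zero_less_mult_iff)
    have Geq: "G = f + fps_const ((s - 1) * a) * fps_X ^ k"
      by (simp add: G_def B_def A_def algebra_simps flip: fps_const_mult fps_const_sub)
    have rad0: "fps_conv_radius (fps_const ((s - 1) * a) * fps_X ^ k) = \<infinity>"
      using fps_conv_radius_mult[of "fps_const ((s - 1) * a)" "fps_X ^ k"] by simp
    have rad: "ereal x < fps_conv_radius G"
      using fps_conv_radius_add[of f "fps_const ((s - 1) * a) * fps_X ^ k"] x
      by (simp add: Geq rad0)
    have "eval_fps G x = F + (s - 1) * a * x ^ k"
      unfolding Geq using x rad0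
      by (simp add: eval_fps_add eval_fps_mult eval_fps_power F_def)
    also have "\<dots> = F * (1 + (s - 1) * p)" using F by (simp add: p_def field_simps)
    finally have evG: "eval_fps G x = F * (1 + (s - 1) * p)" .
    have Apow: "fps_nth (A * f ^ (m i - 1)) (n i) = a * fps_nth (f ^ (m i - 1)) (n i - k)"
      using elim(3) by (simp add: A_def mult.assoc fps_X_power_mult_nth)
    have "u * exp (real (m i) * r i * ln s) \<le> fps_nth (G ^ m i) (n i)"
      using exp_tilt_power_lower[OF A B s, of "m i" "n i"] u
      unfolding AB Apow by (simp add: u_def r_def G_def mult_ac)
    hence "u * exp (real (m i) * r i * ln s) * x ^ n i \<le> fps_nth (G ^ m i) (n i) * x ^ n i"
      using x by (intro mult_right_mono) auto
    also have "\<dots> \<le> eval_fps (G ^ m i) x"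
      by (rule nonneg_fps_coeff_le_eval)
        (use x rad less_le_trans[OF rad fps_conv_radius_power] nonneg_fps_power[OF G] in auto)
    also have "\<dots> = (F * (1 + (s - 1) * p)) ^ m i"
      using rad x by (simp add: eval_fps_power evG)
    also have "\<dots> \<le> (F * exp ((s - 1) * p)) ^ m i"
    proof (intro power_mono mult_left_mono exp_ge_add_one_self)
      have "0 \<le> (1 - p) + s * p" using p s by simp
      hence "0 \<le> 1 + (s - 1) * p" by (simp add: algebra_simps)
      thus "0 \<le> F * (1 + (s - 1) * p)" using F by (intro mult_nonneg_nonneg) auto
    qed (use F in auto)
    also have "\<dots> = F ^ m i * exp (real (m i) * ((s - 1) * p))"
      by (simp add: power_mult_distrib exp_of_nat_mult)
    finally have up: "u * exp (real (m i) * r i * ln s) * x ^ n i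
        \<le> F ^ m i * exp (real (m i) * ((s - 1) * p))" .
    have "F ^ m i * exp (- \<epsilon> * real (m i)) * exp (real (m i) * r i * ln s)
        \<le> u * x ^ n i * exp (real (m i) * r i * ln s)"
      using elim(1) by (intro mult_right_mono) (auto simp: u_def F_def)
    also have "\<dots> \<le> F ^ m i * exp (real (m i) * ((s - 1) * p))" using up by (simp add: mult_ac)
    finally have "exp (- \<epsilon> * real (m i) + real (m i) * r i * ln s) \<le> exp (real (m i) * ((s - 1) * p))"
      using F by (simp only: exp_add mult.assoc mult_le_cancel_left_pos zero_less_power)
    hence "real (m i) * (r i * ln s) \<le> real (m i) * ((s - 1) * p + \<epsilon>)"
      unfolding exp_le_cancel_iff by (simp add: algebra_simps)
    thus ?case using elim(2) by simp
  qed
  have lim: "((\<lambda>h. (exp h - 1) / h * p + h) \<longlongrightarrow> p) (at 0 within S)" for S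
  proof -
    have "((\<lambda>h. (exp h - 1) / h * p + h) \<longlongrightarrow> 1 * p + 0) (at 0)"
      by (intro tendsto_intros lim_exp_minus_1)
    hence "((\<lambda>h. (exp h - 1) / h * p + h) \<longlongrightarrow> p) (at 0)" by (simp only: mult_1 add_0_right)
    thus ?thesis by (rule tendsto_within_subset) simp
  qed
  have "r \<longlonglongrightarrow> p"
  proof (rule order_tendstoI)
    fix b assume b: "p < b"
    have "eventually (\<lambda>h. (exp h - 1) / h * p + h < b) (at_right 0)"
      using lim b by (rule order_tendstoD)
    moreover have "eventually (\<lambda>h::real. h > 0) (at_right 0)" by (rule eventually_at_right_less)
    ultimately obtain h where h: "h > 0" "(exp h - 1) / h * p + h < b"
      using eventually_happens[OF eventually_conj] by force
    show "eventually (\<lambda>i. r i < b) sequentially"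
      using key[of "exp h" "h * h", OF exp_gt_zero mult_pos_pos[OF h(1) h(1)]]
    proof eventually_elim
      case (elim i)
      hence "r i \<le> (exp h - 1) / h * p + h" using h(1) by (simp add: field_simps)
      thus ?case using h by simp
    qed
  next
    fix b assume b: "b < p"
    have "eventually (\<lambda>h. (exp h - 1) / h * p + h > b) (at_left 0)"
      using lim b by (rule order_tendstoD)
    moreover have "eventually (\<lambda>h::real. h < 0) (at_left 0)" by (simp add: eventually_at_filter)
    ultimately obtain h where h: "h < 0" "(exp h - 1) / h * p + h > b"
      using eventually_happens[OF eventually_conj] by force
    show "eventually (\<lambda>i. r i > b) sequentially"
      using key[of "exp h" "h * h", OF exp_gt_zero mult_neg_neg[OF h(1) h(1)]]
    proof eventually_elim
      case (elim i)
      hence "r i \<ge> (exp h - 1) / h * p + h" using h(1) by (simp add: field_simps)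
      thus ?case using h by simp
    qed
  qed
  thus ?thesis by (simp add: r_def p_def a_def F_def)
qed

section \<open>From transpositions to forests\<close>

lemma permutation_orbit_eqI:
  assumes "permutation f" "y \<in> orbit f x"
  shows "orbit f y = orbit f x"
proof (intro subset_antisym subsetI)
  fix z
  show "z \<in> orbit f x" if "z \<in> orbit f y" using that assms(2) by (rule orbit_trans)
  have "x \<in> orbit f y" by (rule orbit_swap[OF permutation_self_in_orbit[OF assms(1)] assms(2)])
  thus "z \<in> orbit f y" if "z \<in> orbit f x" using that by (rule orbit_trans[rotated])
qed

text \<open>
  Starting from \<open>b\<close>, the new permutation moves on to \<open>f a\<close> and then follows the old cycle of \<open>a\<close>.
\<close>

lemma orbit_subset_merge:
  assumes "permutation f" "b \<notin> orbit f a"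
  shows "orbit f a \<subseteq> orbit (f \<circ> Transposition.transpose a b) b"
proof
  fix y assume "y \<in> orbit f a"
  thus "y \<in> orbit (f \<circ> Transposition.transpose a b) b"
  proof (induction rule: orbit.induct)
    case base
    have "f a = (f \<circ> Transposition.transpose a b) b" by simp
    thus ?case using orbit.base[of "f \<circ> Transposition.transpose a b" b] by (simp only:)
  next
    case (step y)
    show ?case
    proof (cases "y = a")
      case True
      have "f a = (f \<circ> Transposition.transpose a b) b" by simp
      thus ?thesis using orbit.base[of "f \<circ> Transposition.transpose a b" b] True by (simp only:)
    next
      case False
      have "y \<noteq> b" using step.hyps assms(2) by auto
      hence "f y = (f \<circ> Transposition.transpose a b) y" using False by simp
      thus ?thesis using orbit.step[OF step.IH] by (simp only:)
    qed
  qed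
qed

text \<open>
  The preceding lemma, applied in both directions, puts the old cycles of \<open>a\<close> and \<open>b\<close> into one new
  cycle. That cycle is not larger than their union, because the union is invariant under the new
  permutation, which agrees with \<open>f\<close> outside of it.
\<close>

lemma orbit_comp_transpose:
  assumes f: "permutation f" and ab: "b \<notin> orbit f a"
  shows "orbit (f \<circ> Transposition.transpose a b) x =
           (if x \<in> orbit f a \<union> orbit f b then orbit f a \<union> orbit f b else orbit f x)"
proof -
  define g where "g = f \<circ> Transposition.transpose a b"
  define U where "U = orbit f a \<union> orbit f b"
  have g: "permutation g" unfolding g_def by (intro permutation_compose f permutation_swap_id)
  have self: "y \<in> orbit f y" for y by (rule permutation_self_in_orbit[OF f])
  have ba: "a \<notin> orbit f b" using ab orbit_swap[OF self, of a b] by blast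
  have g_simps: "g a = f b" "g b = f a" "y \<noteq> a \<Longrightarrow> y \<noteq> b \<Longrightarrow> g y = f y" for y
    by (simp_all add: g_def)
  have 1: "orbit f a \<subseteq> orbit g b" unfolding g_def by (rule orbit_subset_merge[OF f ab])
  have 2: "orbit f b \<subseteq> orbit g a"
    unfolding g_def using orbit_subset_merge[OF f ba] by (simp add: transpose_commute)
  have gab: "orbit g a = orbit g b" by (rule permutation_orbit_eqI[OF g]) (use 1 self in blast)
  have stepU: "g y \<in> U" if "y \<in> U" for y
  proof -
    consider "y = a" | "y = b" | "y \<noteq> a" "y \<noteq> b" by blast
    thus ?thesis using that
      by cases (auto simp: g_simps U_def intro: orbit.intros)
  qed
  have aU: "a \<in> U" "b \<in> U" using self by (simp_all add: U_def)
  have "orbit g a \<subseteq> U"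
  proof
    fix y assume "y \<in> orbit g a"
    thus "y \<in> U" by induction (use stepU aU in auto)
  qed
  hence gU: "orbit g a = U" using 1 2 gab by (auto simp: U_def)
  show ?thesis
  proof (cases "x \<in> U")
    case True
    hence "orbit g x = orbit g a" using gU by (intro permutation_orbit_eqI[OF g]) simp
    thus ?thesis using True gU by (simp add: U_def g_def)
  next
    case False
    have fx: "y \<notin> U" if "y \<in> orbit f x" for y
    proof
      assume "y \<in> U"
      moreover have "x \<in> orbit f y" by (rule orbit_swap[OF self that])
      ultimately have "x \<in> U" unfolding U_def using orbit_trans by fast
      thus False using False by simp
    qed
    have gf: "g y = f y" if "y \<in> orbit f x \<or> y = x" for y
      using that fx[of y] False aU by (intro g_simps) auto
    have "orbit g x = orbit f x"
    proof (intro subset_antisym subsetI)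
      fix y assume "y \<in> orbit g x"
      thus "y \<in> orbit f x"
      proof induction
        case base
        show ?case using gf[of x] orbit.base[of f x] by simp
      next
        case (step y)
        show ?case using gf[of y] step.IH orbit.step[OF step.IH] by simp
      qed
    next
      fix y assume "y \<in> orbit f x"
      thus "y \<in> orbit g x"
      proof induction
        case base
        show ?case using gf[of x] orbit.base[of g x] by simp
      next
        case (step y)
        show ?case using gf[of y] step.hyps orbit.step[OF step.IH] by simp
      qed
    qed
    thus ?thesis using False by (simp add: U_def g_def)
  qed
qed

text \<open>
  Identifies a transposition with the edge that joins the two indices it exchanges.
\<close>

definition support :: "('a \<Rightarrow> 'a) \<Rightarrow> 'a set" where
  "support f = {x. f x \<noteq> x}"

lemma support_transpose: "a \<noteq> b \<Longrightarrow> support (Transposition.transpose a b) = {a, b}"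
  by (auto simp: support_def Transposition.transpose_def)

lemma transpositionsE:
  assumes "\<tau> \<in> transpositions n"
  obtains a b where "\<tau> = Transposition.transpose a b" "a \<in> {1..n}" "b \<in> {1..n}" "a \<noteq> b"
  using assms unfolding transpositions_def by blast

lemma bij_betw_support: "bij_betw support (transpositions n) (edges {1..n})"
proof (rule bij_betwI')
  fix \<sigma> \<tau> assume "\<sigma> \<in> transpositions n" "\<tau> \<in> transpositions n"
  then obtain a b c d where 1: "\<sigma> = Transposition.transpose a b" "a \<noteq> b"
    and 2: "\<tau> = Transposition.transpose c d" "c \<noteq> d" by (metis transpositionsE)
  show "support \<sigma> = support \<tau> \<longleftrightarrow> \<sigma> = \<tau>"
  proof
    assume "support \<sigma> = support \<tau>"
    hence "{a, b} = {c, d}" using 1 2 by (simp add: support_transpose)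
    thus "\<sigma> = \<tau>" unfolding doubleton_eq_iff 1(1) 2(1) by (auto simp: transpose_commute)
  qed simp
next
  fix \<tau> assume "\<tau> \<in> transpositions n"
  then obtain a b where "\<tau> = Transposition.transpose a b" "a \<in> {1..n}" "b \<in> {1..n}" "a \<noteq> b"
    by (rule transpositionsE)
  thus "support \<tau> \<in> edges {1..n}" by (simp add: support_transpose)
next
  fix e assume "e \<in> edges {1..n}"
  then obtain a b where e: "e = {a, b}" "a \<noteq> b" "a \<in> {1..n}" "b \<in> {1..n}" by (rule edgesE)
  hence "Transposition.transpose a b \<in> transpositions n" unfolding transpositions_def by blast
  thus "\<exists>\<tau>\<in>transpositions n. e = support \<tau>" using e support_transpose[of a b] by blast
qed

abbreviation endpoint :: "(nat \<Rightarrow> nat) list \<Rightarrow> nat \<Rightarrow> nat" where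
  "endpoint \<tau>s \<equiv> walk \<tau>s (length \<tau>s)"

lemma endpoint_snoc: "endpoint (\<tau>s @ [\<tau>]) = endpoint \<tau>s \<circ> \<tau>"
  by (simp add: walk_def)

lemma no_fragmentation_snoc:
  "no_fragmentation (\<tau>s @ [\<tau>]) \<longleftrightarrow> no_fragmentation \<tau>s \<and> \<not> fragmentation (endpoint \<tau>s) \<tau>"
proof -
  have "walk (\<tau>s @ [\<tau>]) i = walk \<tau>s i" if "i \<le> length \<tau>s" for i
    using that by (simp add: walk_def)
  thus ?thesis
    by (auto simp: no_fragmentation_def less_Suc_eq nth_append)
qed

lemma permutation_endpoint:
  "set \<tau>s \<subseteq> transpositions n \<Longrightarrow> permutation (endpoint \<tau>s)"
proof (induction \<tau>s rule: rev_induct)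
  case Nil
  show ?case by (simp add: walk_def permutation_id)
next
  case (snoc \<tau> \<tau>s)
  then obtain a b where "\<tau> = Transposition.transpose a b" by (auto elim: transpositionsE)
  thus ?case using snoc unfolding endpoint_snoc
    by (intro permutation_compose) (simp_all add: permutation_swap_id)
qed

lemma fragmentation_transpose_iff:
  assumes "permutation \<sigma>" "a \<noteq> b"
  shows "fragmentation \<sigma> (Transposition.transpose a b) \<longleftrightarrow> b \<in> orbit \<sigma> a"
proof
  assume "fragmentation \<sigma> (Transposition.transpose a b)"
  then obtain c d where cd: "c \<noteq> d" "Transposition.transpose a b = Transposition.transpose c d" "d \<in> orbit \<sigma> c"
    unfolding fragmentation_def by blast
  have "{a, b} = {c, d}"
    using support_transpose[OF assms(2)] support_transpose[OF cd(1)] cd(2) by simp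
  moreover have "c \<in> orbit \<sigma> d"
    by (rule orbit_swap[OF permutation_self_in_orbit[OF assms(1)] cd(3)])
  ultimately show "b \<in> orbit \<sigma> a" using cd(3) unfolding doubleton_eq_iff by blast
next
  assume "b \<in> orbit \<sigma> a"
  thus "fragmentation \<sigma> (Transposition.transpose a b)"
    using assms(2) unfolding fragmentation_def by blast
qed

text \<open>
  Both statements are proved by one induction over the steps: while the cycles are the components of
  the edges used so far, the next step is a fragmentation exactly when its edge repeats an earlier
  one or closes a cycle of the graph.
\<close>

lemma no_fragmentation_iff_forest:
  assumes "set \<tau>s \<subseteq> transpositions n"
  shows "no_fragmentation \<tau>s \<longleftrightarrow> distinct (map support \<tau>s) \<and> forest (set (map support \<tau>s))"
    and "no_fragmentation \<tau>s \<Longrightarrow> orbit (endpoint \<tau>s) x = part (set (map support \<tau>s)) x"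
proof -
  have "(no_fragmentation \<tau>s \<longleftrightarrow> distinct (map support \<tau>s) \<and> forest (set (map support \<tau>s))) \<and>
    (no_fragmentation \<tau>s \<longrightarrow> (\<forall>x. orbit (endpoint \<tau>s) x = part (set (map support \<tau>s)) x))"
    using assms
  proof (induction \<tau>s rule: rev_induct)
    case Nil
    have "orbit (\<lambda>a. a) x = {x}" for x :: nat by (simp add: orbit_eq_singleton_iff)
    moreover have "part {} x = {x}" for x :: nat by (simp add: part_def conn_def)
    ultimately show ?case by (simp add: no_fragmentation_def walk_def)
  next
    case (snoc \<tau> \<tau>s)
    define E where "E = set (map support \<tau>s)"
    have sub: "set \<tau>s \<subseteq> transpositions n" and "\<tau> \<in> transpositions n" using snoc.prems by auto
    then obtain a b where \<tau>: "\<tau> = Transposition.transpose a b" "a \<noteq> b" by (metis transpositionsE)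
    have perm: "permutation (endpoint \<tau>s)" by (rule permutation_endpoint[OF sub])
    have IH1: "no_fragmentation \<tau>s \<longleftrightarrow> distinct (map support \<tau>s) \<and> forest E"
      and IH2: "no_fragmentation \<tau>s \<Longrightarrow> orbit (endpoint \<tau>s) x = part E x" for x
      using snoc.IH[OF sub] by (auto simp: E_def)
    have supp: "support \<tau> = {a, b}" using \<tau> by (simp add: support_transpose)
    have set_snoc: "set (map support (\<tau>s @ [\<tau>])) = insert {a, b} E"
      by (simp add: E_def supp)
    have dist_snoc: "distinct (map support (\<tau>s @ [\<tau>])) \<longleftrightarrow> distinct (map support \<tau>s) \<and> {a, b} \<notin> E"
      by (auto simp: E_def supp)
    have nf: "no_fragmentation (\<tau>s @ [\<tau>]) \<longleftrightarrow> no_fragmentation \<tau>s \<and> b \<notin> orbit (endpoint \<tau>s) a"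
      unfolding no_fragmentation_snoc \<tau>(1) fragmentation_transpose_iff[OF perm \<tau>(2)] by simp
    show ?case
    proof (cases "no_fragmentation \<tau>s")
      case False
      have "\<not> (distinct (map support \<tau>s) \<and> forest (insert {a, b} E))"
        using False IH1 forest_subset[of "insert {a, b} E" E] by blast
      thus ?thesis unfolding nf set_snoc dist_snoc using False by simp
    next
      case True
      have iff: "b \<notin> orbit (endpoint \<tau>s) a \<longleftrightarrow> (a, b) \<notin> conn E"
        unfolding IH2[OF True] by (simp add: part_def)
      have "{a, b} \<notin> E \<and> forest (insert {a, b} E) \<longleftrightarrow> (a, b) \<notin> conn E"
        using forest_insert[of a b E] edge_conn[of a b E] True IH1 by blast
      moreover have "orbit (endpoint (\<tau>s @ [\<tau>])) x = part (insert {a, b} E) x"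
        if "b \<notin> orbit (endpoint \<tau>s) a" for x
        unfolding endpoint_snoc \<tau>(1) orbit_comp_transpose[OF perm that] part_insert IH2[OF True] ..
      ultimately show ?thesis
        unfolding nf set_snoc dist_snoc using True IH1 iff by blast
    qed
  qed
  thus "no_fragmentation \<tau>s \<longleftrightarrow> distinct (map support \<tau>s) \<and> forest (set (map support \<tau>s))"
    and "no_fragmentation \<tau>s \<Longrightarrow> orbit (endpoint \<tau>s) x = part (set (map support \<tau>s)) x"
    by auto
qed

definition step_lists :: "nat \<Rightarrow> nat \<Rightarrow> (nat \<Rightarrow> nat) list set" where
  "step_lists n t = {\<tau>s. set \<tau>s \<subseteq> transpositions n \<and> length \<tau>s = t}"

lemma card_distinct_lists:
  assumes "finite \<F>" "\<And>E. E \<in> \<F> \<Longrightarrow> finite E \<and> card E = t"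
  shows "card {ys. distinct ys \<and> set ys \<in> \<F>} = fact t * card \<F>"
proof -
  have "{ys. distinct ys \<and> set ys \<in> \<F>} = (\<Union>E\<in>\<F>. permutations_of_set E)"
    by (auto simp: permutations_of_set_def)
  also have "card \<dots> = (\<Sum>E\<in>\<F>. card (permutations_of_set E))"
  proof (rule card_UN_disjoint)
    show "\<forall>E\<in>\<F>. \<forall>E'\<in>\<F>. E \<noteq> E' \<longrightarrow> permutations_of_set E \<inter> permutations_of_set E' = {}"
      unfolding permutations_of_set_def by blast
  qed (use assms in simp_all)
  also have "\<dots> = (\<Sum>E\<in>\<F>. fact t)"
    using assms by (intro sum.cong) simp_all
  finally show ?thesis by simp
qed

lemma card_no_fragmentation_lists:
  "card {\<tau>s \<in> step_lists n t. no_fragmentation \<tau>s \<and> P (set (map support \<tau>s))} =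
     fact t * card {E \<in> forests {1..n} t. P E}"
proof -
  define X where "X = {\<tau>s \<in> step_lists n t. no_fragmentation \<tau>s \<and> P (set (map support \<tau>s))}"
  define Y where "Y = {ys. distinct ys \<and> set ys \<in> {E \<in> forests {1..n} t. P E}}"
  have bij: "bij_betw (map support) (lists (transpositions n)) (lists (edges {1..n}))"
    by (rule bij_lists[OF bij_betw_support])
  have mem: "\<tau>s \<in> X \<longleftrightarrow> map support \<tau>s \<in> Y" if "\<tau>s \<in> lists (transpositions n)" for \<tau>s
  proof -
    have sub: "set \<tau>s \<subseteq> transpositions n" using that by auto
    have "set (map support \<tau>s) \<subseteq> edges {1..n}"
      using sub bij_betw_support[of n] by (auto simp: bij_betw_def)
    moreover have "distinct (map support \<tau>s) \<Longrightarrow> card (set (map support \<tau>s)) = t \<longleftrightarrow> length \<tau>s = t"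
      using distinct_card[of "map support \<tau>s"] by simp
    ultimately show ?thesis
      unfolding X_def Y_def step_lists_def forests_def mem_Collect_eq no_fragmentation_iff_forest(1)[OF sub]
      using sub by blast
  qed
  have "X \<subseteq> lists (transpositions n)" by (auto simp: X_def step_lists_def)
  hence "bij_betw (map support) X (map support ` X)"
    by (intro inj_on_imp_bij_betw inj_on_subset[OF bij_betw_imp_inj_on[OF bij]])
  moreover have "map support ` X = Y"
  proof (intro subset_antisym subsetI)
    fix ys assume "ys \<in> map support ` X"
    thus "ys \<in> Y" using mem \<open>X \<subseteq> lists (transpositions n)\<close> by blast
  next
    fix ys assume ys: "ys \<in> Y"
    hence "ys \<in> lists (edges {1..n})" by (auto simp: Y_def forests_def)
    then obtain \<tau>s where "\<tau>s \<in> lists (transpositions n)" "ys = map support \<tau>s"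
      using bij unfolding bij_betw_def by blast
    thus "ys \<in> map support ` X" using mem ys by blast
  qed
  ultimately have "card X = card Y" using bij_betw_same_card by blast
  also have "card Y = fact t * card {E \<in> forests {1..n} t. P E}"
    unfolding Y_def
  proof (rule card_distinct_lists)
    show "finite {E \<in> forests {1..n} t. P E}" by (simp add: finite_forests)
    show "finite E \<and> card E = t" if "E \<in> {E \<in> forests {1..n} t. P E}" for E
      using that finite_subset[OF _ finite_edges[of "{1..n}"]] by (auto simp: forests_def)
  qed
  finally show ?thesis by (simp add: X_def)
qed

lemma pmf_replicate_uniform:
  assumes "finite A" "A \<noteq> {}" "set xs \<subseteq> A" "length xs = t"
  shows "pmf (replicate_pmf t (pmf_of_set A)) xs = (1 / real (card A)) ^ t"
  using assms(3,4)
proof (induction t arbitrary: xs)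
  case (Suc t)
  then obtain y ys where xs: "xs = y # ys" by (cases xs) auto
  have "replicate_pmf (Suc t) (pmf_of_set A) =
      map_pmf (\<lambda>(x, xs). x # xs) (pair_pmf (pmf_of_set A) (replicate_pmf t (pmf_of_set A)))"
    by (simp add: pair_pmf_def map_bind_pmf)
  hence "pmf (replicate_pmf (Suc t) (pmf_of_set A)) xs =
      pmf (map_pmf (\<lambda>(x, xs). x # xs) (pair_pmf (pmf_of_set A) (replicate_pmf t (pmf_of_set A))))
        ((\<lambda>(x, xs). x # xs) (y, ys))"
    by (simp add: xs)
  also have "\<dots> = pmf (pair_pmf (pmf_of_set A) (replicate_pmf t (pmf_of_set A))) (y, ys)"
    by (rule pmf_map_inj') (auto simp: inj_def)
  also have "\<dots> = (1 / real (card A)) ^ Suc t"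
    using Suc.prems Suc.IH[of ys] assms(1,2) by (simp add: pmf_pair xs)
  finally show ?case .
qed simp

lemma prob_cond_pmf:
  assumes "set_pmf p \<inter> S \<noteq> {}"
  shows "measure_pmf.prob (cond_pmf p S) A = measure_pmf.prob p (A \<inter> S) / measure_pmf.prob p S"
  using assms emeasure_measure_pmf_not_zero[OF assms]
  by (simp add: cond_pmf.rep_eq measure_uniform_measure Int_commute)

lemma prob_cond_replicate_uniform:
  assumes A: "finite A" "A \<noteq> {}" and N: "{xs. set xs \<subseteq> A \<and> length xs = t} \<inter> N \<noteq> {}"
  shows "measure_pmf.prob (cond_pmf (replicate_pmf t (pmf_of_set A)) N) Q =
     real (card ({xs. set xs \<subseteq> A \<and> length xs = t} \<inter> N \<inter> Q)) /
     real (card ({xs. set xs \<subseteq> A \<and> length xs = t} \<inter> N))"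
proof -
  define p where "p = replicate_pmf t (pmf_of_set A)"
  define L where "L = {xs. set xs \<subseteq> A \<and> length xs = t}"
  have fin: "finite L" using finite_lists_length_eq[OF A(1)] by (simp add: L_def)
  have sp: "set_pmf p = L" using A by (auto simp: p_def set_replicate_pmf L_def)
  have prob: "measure_pmf.prob p S = real (card (L \<inter> S)) * (1 / real (card A)) ^ t" for S
  proof -
    have "measure_pmf.prob p S = measure_pmf.prob p (L \<inter> S)"
      using measure_Int_set_pmf[of p S] by (simp add: sp Int_commute)
    also have "\<dots> = (\<Sum>x\<in>L \<inter> S. pmf p x)" using fin by (intro measure_measure_pmf_finite) simp
    also have "\<dots> = (\<Sum>x\<in>L \<inter> S. (1 / real (card A)) ^ t)"
      using pmf_replicate_uniform[OF A] by (intro sum.cong) (auto simp: L_def p_def)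
    finally show ?thesis by simp
  qed
  have "card A > 0" using A by (simp add: card_gt_0_iff)
  thus ?thesis
    using prob_cond_pmf[of p N Q] N unfolding p_def[symmetric] L_def[symmetric]
    by (simp add: sp prob Int_commute Int_left_commute Int_assoc)
qed

text \<open>
  Take \<open>t\<close> edges of a spanning tree, which exists by Cayley's formula.
\<close>

lemma forests_nonempty:
  assumes "finite V" "t < card V"
  shows "forests V t \<noteq> {}"
proof -
  have "V \<noteq> {}" using assms(2) by auto
  hence "card (forests V (card V - 1)) \<noteq> 0"
    using card_spanning_trees[OF assms(1)] assms(2) by simp
  hence "forests V (card V - 1) \<noteq> {}" by (intro notI) simp
  then obtain E where E: "E \<in> forests V (card V - 1)" by blast
  hence "t \<le> card E" using assms(2) by (simp add: forests_def)
  hence "\<exists>E'. E' \<subseteq> E \<and> card E' = t"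
    by (rule obtain_subset_with_card_n) blast
  then obtain E' where "E' \<subseteq> E" "card E' = t" by blast
  hence "E' \<in> forests V t" using E forest_subset[of E E'] by (auto simp: forests_def)
  thus ?thesis by blast
qed

text \<open>
  Each forest with \<open>t\<close> edges is the set of supports of \<open>t!\<close> step lists, so the factors \<open>t!\<close> cancel.
  Since \<open>t < n\<close>, such forests exist and the conditioning is meaningful.
\<close>

lemma nu0_cycle_length:
  assumes n: "2 \<le> n" and t: "t < n"
  shows "measure_pmf.prob (nu0 n t) {\<sigma>. card (orbit \<sigma> 1) = k} =
     real (card {E \<in> forests {1..n} t. card (part E 1) = k}) / real (card (forests {1..n} t))"
proof -
  define L where "L = {\<tau>s. set \<tau>s \<subseteq> transpositions n \<and> length \<tau>s = t}"
  define N where "N = {\<tau>s. no_fragmentation \<tau>s}"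
  define Q where "Q = {\<tau>s. card (orbit (walk \<tau>s t) 1) = k}"
  have "finite (transpositions n)"
    using bij_betw_finite[OF bij_betw_support[of n]] finite_edges[of "{1..n}"] by simp
  moreover have "transpositions n \<noteq> {}"
  proof -
    have "Transposition.transpose 1 2 \<in> transpositions n" using n unfolding transpositions_def by force
    thus ?thesis by blast
  qed
  moreover have LN: "card (L \<inter> N) = fact t * card (forests {1..n} t)"
    using card_no_fragmentation_lists[of n t "\<lambda>_. True"]
    by (simp add: L_def N_def step_lists_def Int_def conj_assoc)
  moreover have pos: "card (forests {1..n} t) > 0"
    using forests_nonempty[of "{1..n}" t] finite_forests[of "{1..n}" t] t by (simp add: card_gt_0_iff)
  ultimately have "measure_pmf.prob (cond_pmf (replicate_pmf t (pmf_of_set (transpositions n))) N) Q =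
      real (card (L \<inter> N \<inter> Q)) / real (card (L \<inter> N))"
    unfolding L_def by (intro prob_cond_replicate_uniform) auto
  moreover have "card (L \<inter> N \<inter> Q) = fact t * card {E \<in> forests {1..n} t. card (part E 1) = k}"
  proof -
    have "L \<inter> N \<inter> Q = {\<tau>s \<in> step_lists n t. no_fragmentation \<tau>s \<and> card (part (set (map support \<tau>s)) 1) = k}"
      using no_fragmentation_iff_forest(2)[of _ n 1]
      by (auto simp: L_def N_def Q_def step_lists_def)
    thus ?thesis using card_no_fragmentation_lists[of n t "\<lambda>E. card (part E 1) = k"] by simp
  qed
  moreover have "measure_pmf.prob (nu0 n t) {\<sigma>. card (orbit \<sigma> 1) = k} =
      measure_pmf.prob (cond_pmf (replicate_pmf t (pmf_of_set (transpositions n))) N) Q"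
    by (simp add: nu0_def N_def Q_def vimage_def)
  ultimately show ?thesis unfolding LN using pos by (simp only: of_nat_mult) simp
qed


section \<open>The limit law\<close>

theorem theorem4:
  fixes c :: real and k :: nat
  assumes "0 < c" and "c < 1" and "k \<ge> 1"
  shows "(\<lambda>n. measure_pmf.prob (nu0 n (nat \<lfloor>c * real n / 2\<rfloor>)) {\<sigma>. card (orbit \<sigma> 1) = k})
           \<longlonglongrightarrow> 1 / c * (real k ^ (k - 1) / fact k) * (c * exp (- c)) ^ k"
proof -
  define t where "t = (\<lambda>n. nat \<lfloor>c * real n / 2\<rfloor>)"
  define m where "m = (\<lambda>n. n - t n)"
  define x where "x = c * exp (- c)"
  define p where "p = fps_nth tree_fps k * x ^ k / eval_fps tree_fps x"
  have x: "x > 0" "\<bar>x\<bar> < exp (- 1)" using assms tree_fps_at_saddle(1)[of c] by (auto simp: x_def)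
  have xr: "ereal x < fps_conv_radius tree_fps" using tree_fps_conv_radius[OF x(2)] x(1) by simp
  have ev: "eval_fps tree_fps x = c * (1 - c / 2)"
    using tree_fps_at_saddle(3)[of c] assms by (simp add: x_def)
  have mean: "x * eval_fps (fps_deriv tree_fps) x / eval_fps tree_fps x = 1 / (1 - c / 2)"
    using eval_rooted_tree_fps_eq[OF x(2)] tree_fps_at_saddle(2)[of c] assms
    by (simp add: ev) (simp add: x_def)
  have t_bounds: "real (t n) \<le> c / 2 * real n" "c / 2 * real n - 1 \<le> real (t n)" for n
  proof -
    have "0 \<le> c * real n / 2" using assms by simp
    hence "real (t n) = of_int \<lfloor>c * real n / 2\<rfloor>" by (simp add: t_def)
    thus "real (t n) \<le> c / 2 * real n" "c / 2 * real n - 1 \<le> real (t n)" by linarith+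
  qed
  have tn: "t n < n" if "n > 0" for n
  proof -
    have "c / 2 * real n < 1 * real n" using that assms by (intro mult_strict_right_mono) auto
    thus ?thesis using t_bounds(1)[of n] by linarith
  qed
  have m_bounds: "(1 - c / 2) * real n \<le> real (m n)" "real (m n) \<le> (1 - c / 2) * real n + 1" for n
    using t_bounds[of n] tn[of n] by (cases "n = 0"; simp add: m_def of_nat_diff algebra_simps)+
  have mn: "(\<lambda>n. real (m n) / real n) \<longlonglongrightarrow> 1 - c / 2"
  proof (rule tendsto_sandwich)
    show "eventually (\<lambda>n. 1 - c / 2 \<le> real (m n) / real n) sequentially"
      using eventually_gt_at_top[of 0]
      by eventually_elim (use m_bounds(1) in \<open>simp add: pos_le_divide_eq\<close>)
    show "eventually (\<lambda>n. real (m n) / real n \<le> (1 - c / 2) + 1 / real n) sequentially"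
      using eventually_gt_at_top[of 0]
    proof eventually_elim
      case (elim n)
      have "real (m n) / real n \<le> ((1 - c / 2) * real n + 1) / real n"
        by (rule divide_right_mono[OF m_bounds(2)]) simp
      thus ?case using elim by (simp add: add_divide_distrib)
    qed
    show "(\<lambda>n. (1 - c / 2) + 1 / real n) \<longlonglongrightarrow> 1 - c / 2"
      using tendsto_add[OF tendsto_const lim_1_over_n, of "1 - c / 2"] by simp
  qed simp
  have nm: "(\<lambda>n. real n / real (m n)) \<longlonglongrightarrow> 1 / (1 - c / 2)"
    using tendsto_inverse[OF mn] assms by (simp add: inverse_eq_divide)
  have m_top: "filterlim m at_top sequentially"
  proof -
    have "filterlim (\<lambda>n. (1 - c / 2) * real n) at_top sequentially"
      using assms by (intro filterlim_tendsto_pos_mult_at_top[OF tendsto_const] filterlim_real_sequentially) simp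
    hence "filterlim (\<lambda>n. real (m n)) at_top sequentially"
      by (rule filterlim_at_top_mono) (use m_bounds(1) in simp)
    thus ?thesis by (simp add: filterlim_sequentially_iff_filterlim_real)
  qed
  have lim: "(\<lambda>n. fps_nth tree_fps k * fps_nth (tree_fps ^ (m n - 1)) (n - k) / fps_nth (tree_fps ^ m n) n)
      \<longlonglongrightarrow> p"
    unfolding p_def
  proof (rule fps_power_part_frequency[OF _ _ _ x(1) xr mean[symmetric] _ _ m_top nm])
    show "nonneg_fps tree_fps" by (simp add: nonneg_fps_def tree_fps_def)
    show "0 < fps_nth tree_fps 1" "0 < fps_nth tree_fps 2" by (simp_all add: tree_fps_def)
    show "1 < 1 / (1 - c / 2)" "1 / (1 - c / 2) < 2" using assms by (simp_all add: field_simps)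
  qed
  have ev_eq: "eventually (\<lambda>n. real k * (real (m n) / real n) *
      (fps_nth tree_fps k * fps_nth (tree_fps ^ (m n - 1)) (n - k) / fps_nth (tree_fps ^ m n) n) =
      measure_pmf.prob (nu0 n (t n)) {\<sigma>. card (orbit \<sigma> 1) = k}) sequentially"
    using eventually_ge_at_top[of "max 2 k"]
  proof eventually_elim
    case (elim n)
    have "card {1..n} = n" by simp
    hence "measure_pmf.prob (nu0 n (t n)) {\<sigma>. card (orbit \<sigma> 1) = k} = real k * (real (m n) / real n) *
        (fps_nth tree_fps k * fps_nth (tree_fps ^ (m n - 1)) (n - k) / fps_nth (tree_fps ^ m n) n)"
      using nu0_cycle_length[of n "t n" k] tn[of n] elim assms(3)
        card_forests_part_size_ratio[of "{1..n}" 1 "t n" k] by (simp add: m_def)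
    thus ?case by simp
  qed
  have "(\<lambda>n. real k * (real (m n) / real n) *
      (fps_nth tree_fps k * fps_nth (tree_fps ^ (m n - 1)) (n - k) / fps_nth (tree_fps ^ m n) n))
      \<longlonglongrightarrow> real k * (1 - c / 2) * p"
    by (intro tendsto_mult tendsto_const mn lim)
  hence "(\<lambda>n. measure_pmf.prob (nu0 n (t n)) {\<sigma>. card (orbit \<sigma> 1) = k})
      \<longlonglongrightarrow> real k * (1 - c / 2) * p"
    using ev_eq by (rule Lim_transform_eventually)
  moreover have "real k * (1 - c / 2) * p = 1 / c * (real k ^ (k - 1) / fact k) * (c * exp (- c)) ^ k"
  proof -
    have pw: "real k * real k ^ (k - 2) = real k ^ (k - 1)"
    proof (cases "k = 1")
      case False
      hence "k - 1 = Suc (k - 2)" using assms(3) by simp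
      thus ?thesis by (simp only: power_Suc)
    qed simp
    have "fps_nth tree_fps k = real k ^ (k - 2) / fact k"
      using assms(3) by (simp add: tree_fps_def)
    hence "real k * (1 - c / 2) * p = 1 / c * (real k * real k ^ (k - 2) / fact k) * x ^ k"
      using assms(1,2) by (simp add: p_def ev mult_ac)
    thus ?thesis unfolding pw by (simp only: x_def)
  qed
  ultimately show ?thesis by (simp add: t_def)
qed

end
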